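(* Let $G$ be a minimal $(k,g)$-cage, where $g$ is even, or $g=3$, or $g=5$, and let $d=\lfloor g/2\rfloor$. Define the polynomial $p(x)$ by $$p(x)=\sum_{i=0}^{d-1}\Big[i+\sum_{j=1}^{\lfloor (d-i-1)/2\rfloor}(-1)^{j}(i+2j)(k-1)^{j-1}a_{i+2j}^{j}\Big]x^{i}+\frac{d}{k}\Big[x^{d}+\sum_{i=1}^{\lfloor d/2\rfloor}(-1)^{i}(k-1)^{i-1}a_{d}^{i}x^{d-2i}\Big]$$ if $g$ is even (the inner sum over $j$ is present only when $d-i\ge 3$), by $p(x)=x$ if $g=3$, and by $p(x)=2x^{2}+x-2k$ if $g=5$. If $\lambda$ is an eigenvalue of $G$ (that is, of its adjacency matrix), then $p(\lambda)$ is a distance eigenvalue of $G$ with the same multiplicity as that of $\lambda$.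
   Context: All graphs are finite, simple, connected and undirected. The distance matrix $D(G)$ of a graph $G$ on vertices $v_1,\dots,v_n$ is the $n\times n$ matrix whose $(i,j)$ entry is the graph distance between $v_i$ and $v_j$. Eigenvalues of $G$ are the eigenvalues of its adjacency matrix; distance eigenvalues of $G$ are the eigenvalues of $D(G)$. A $(k,g)$-cage is a $k$-regular simple graph of girth $g$ with the minimum possible number of vertices $n(k,g)$. With $d=\lfloor g/2\rfloor$, one has the lower bound $n(k,g)\ge n_0(k,g)$, where $n_0(k,g)=1+\sum_{i=0}^{d-1}k(k-1)^i$ if $g$ is odd, and $n_0(k,g)=1+\sum_{i=0}^{d-2}k(k-1)^i+(k-1)^{d-1}$ if $g$ is even. A minimal $(k,g)$-cage (Moore graph) is a $(k,g)$-cage with exactly $n_0(k,g)$ vertices; its diameter is $d$. The numbers $a_i^j$ ($i,j\in\{0,1,\dots,d\}$) are defined by: $a_0^0=k$; $a_i^0=k-1$ for $1\le i\le d$; and for $j\ge 1$, $a_i^j=a_{i-1}^{j}+a_{i-2}^{j-1}$ if $1\le j\le\lfloor i/2\rfloor$, and $a_i^j=0$ otherwise.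
   Formalization: Equality of multiplicities is claimed only for k ≥ 3 or g ≤ 6, as it fails for even cycles of length ≥ 8 (C_8: p(0)=p(-2)=0 has multiplicity 3); in all cases the multiplicity of p(λ) is the sum of those of the eigenvalues with the same p-value. *)

theory Defs
  imports
    "Graph_Theory.Graph_Theory"
    "Jordan_Normal_Form.Char_Poly"
    "HOL-Library.Extended_Nat"
begin

text \<open>
  Simple graphs are the symmetric digraphs of the locale \<^locale>\<open>graph\<close>: every edge is a
  pair of opposite arcs. Such a pair is a cycle of length 2 for \<^const>\<open>pre_digraph.cycle\<close>,
  but not in the undirected graph, whence the restriction to length at least 3 below.
  The girth of an acyclic graph is infinite.
\<close>

definition girth :: "('a, 'b) pre_digraph \<Rightarrow> enat" where
  "girth G = (INF p \<in> {p. pre_digraph.cycle G p \<and> 3 \<le> length p}. enat (length p))"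

definition regular :: "nat \<Rightarrow> ('a, 'b) pre_digraph \<Rightarrow> bool" where
  "regular k G \<longleftrightarrow> (\<forall>v \<in> verts G. out_degree G v = k)"

definition kg_graph :: "nat \<Rightarrow> nat \<Rightarrow> ('a, 'b) pre_digraph \<Rightarrow> bool" where
  "kg_graph k g G \<longleftrightarrow>
     graph G \<and> Digraph_Component.connected G \<and> regular k G \<and> girth G = enat g"

text \<open>
  The order \<open>n(k,g)\<close> of a cage. Every finite simple graph is isomorphic to one with natural
  numbers as vertices and pairs of them as arcs, so the choice of types is no restriction.
\<close>

definition cage_order :: "nat \<Rightarrow> nat \<Rightarrow> nat" where
  "cage_order k g =
     (LEAST n. \<exists>H :: (nat, nat \<times> nat) pre_digraph. kg_graph k g H \<and> card (verts H) = n)"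

definition cage :: "nat \<Rightarrow> nat \<Rightarrow> ('a, 'b) pre_digraph \<Rightarrow> bool" where
  "cage k g G \<longleftrightarrow> kg_graph k g G \<and> card (verts G) = cage_order k g"

definition moore_bound :: "nat \<Rightarrow> nat \<Rightarrow> nat" where
  "moore_bound k g = (let d = g div 2 in
     if odd g then 1 + (\<Sum>i<d. k * (k - 1) ^ i)
     else 1 + (\<Sum>i<d - 1. k * (k - 1) ^ i) + (k - 1) ^ (d - 1))"

definition minimal_cage :: "nat \<Rightarrow> nat \<Rightarrow> ('a, 'b) pre_digraph \<Rightarrow> bool" where
  "minimal_cage k g G \<longleftrightarrow> cage k g G \<and> card (verts G) = moore_bound k g"

definition graph_dist :: "('a, 'b) pre_digraph \<Rightarrow> 'a \<Rightarrow> 'a \<Rightarrow> real" where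
  "graph_dist G u v = real_of_ereal (wf_digraph.\<mu> G (\<lambda>_. 1) u v)"

text \<open>The list \<open>vs\<close> is the enumeration of the vertices that indexes rows and columns.\<close>

definition adjacency_matrix :: "('a, 'b) pre_digraph \<Rightarrow> 'a list \<Rightarrow> real mat" where
  "adjacency_matrix G vs = mat (length vs) (length vs)
     (\<lambda>(i, j). if vs ! i \<rightarrow>\<^bsub>G\<^esub> vs ! j then 1 else 0)"

definition distance_matrix :: "('a, 'b) pre_digraph \<Rightarrow> 'a list \<Rightarrow> real mat" where
  "distance_matrix G vs = mat (length vs) (length vs)
     (\<lambda>(i, j). graph_dist G (vs ! i) (vs ! j))"

text \<open>
  Algebraic multiplicity; both matrices above are real symmetric for a simple graph, so it is
  also the geometric one.
\<close>

definition multiplicity_of :: "real mat \<Rightarrow> real \<Rightarrow> nat" where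
  "multiplicity_of A x = Polynomial.order x (char_poly A)"

text \<open>\<open>a_coeff k i j\<close> is \<open>a\<^sub>i\<^sup>j\<close>; the subscript comes first.\<close>

fun a_coeff :: "nat \<Rightarrow> nat \<Rightarrow> nat \<Rightarrow> real" where
  "a_coeff k i 0 = (if i = 0 then real k else real k - 1)"
| "a_coeff k i (Suc j) =
     (if Suc j \<le> i div 2 then a_coeff k (i - 1) (Suc j) + a_coeff k (i - 2) j else 0)"

definition dist_poly :: "nat \<Rightarrow> nat \<Rightarrow> real poly" where
  "dist_poly k g = (let d = g div 2 in
     if even g then
       (\<Sum>i<d. monom
          (real i + (\<Sum>j = 1..(d - i - 1) div 2.
             (-1) ^ j * real (i + 2 * j) * (real k - 1) ^ (j - 1) * a_coeff k (i + 2 * j) j)) i)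
       + Polynomial.smult (real d / real k)
          (Polynomial.monom 1 d + (\<Sum>i = 1..d div 2.
             Polynomial.monom ((-1) ^ i * (real k - 1) ^ (i - 1) * a_coeff k d i) (d - 2 * i)))
     else if g = 3 then [:0, 1:]
     else [:- 2 * real k, 1, 2:])"

end

theory Submission
  imports Defs "Jordan_Normal_Form.Schur_Decomposition"
begin

text \<open>
  In a Moore graph of diameter \<open>d\<close> the distances from the neighbours of \<open>u\<close> to \<open>v\<close> depend only on
  the distance from \<open>u\<close> to \<open>v\<close>. Hence the distance-\<open>i\<close> matrices satisfy a three-term recurrence
  and the distance matrix is \<open>p(A)\<close>; since \<open>A\<close> is real symmetric, the multiplicity of a
  distance eigenvalue is the sum of the multiplicities of its preimages under \<open>p\<close>.

  It remains that \<open>p\<close> is injective on the spectrum. Let \<open>g = 2 d\<close> and \<open>q = k - 1\<close>. An eigenvalue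
  \<open>x \<noteq> k\<close> satisfies \<open>(k - x) p(x) = 2 w(x) - 2\<close>, where \<open>w(x)/q\<close> is the eigenvalue of the distance-\<open>d\<close>
  matrix, and a quadratic invariant of the recurrence gives \<open>w(x)\<^sup>2 = q\<^bsup>d\<^esup>\<close> if moreover \<open>x \<noteq> -k\<close>.
  For \<open>q > 1\<close> the sign of \<open>p(x)\<close> is that of \<open>w(x)\<close>, so equal values of \<open>p\<close> come from equal
  \<open>w\<close> and hence from equal eigenvalues. The values at \<open>k\<close> and \<open>-k\<close> are separated from the others
  by a maximum argument and by the integrality of the characteristic polynomial of \<open>A\<close>.
\<close>

section \<open>Polynomials in a matrix\<close>

definition mat_poly :: "'a::comm_ring_1 mat \<Rightarrow> 'a poly \<Rightarrow> 'a mat" where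
  "mat_poly A p = fold_coeffs (\<lambda>c M. c \<cdot>\<^sub>m 1\<^sub>m (dim_row A) + A * M) p (0\<^sub>m (dim_row A) (dim_row A))"

lemma mat_poly_0 [simp]: "A \<in> carrier_mat n n \<Longrightarrow> mat_poly A 0 = 0\<^sub>m n n"
  by (simp add: mat_poly_def)

lemma mat_poly_pCons:
  assumes "A \<in> carrier_mat n n"
  shows "mat_poly A (pCons c p) = c \<cdot>\<^sub>m 1\<^sub>m n + A * mat_poly A p"
proof (cases "c = 0 \<and> p = 0")
  case True
  with assms show ?thesis by (intro eq_matI) auto
next
  case False
  with assms show ?thesis
    by (cases "c = 0") (auto simp: mat_poly_def)
qed

lemma mat_poly_carrier [simp]: "A \<in> carrier_mat n n \<Longrightarrow> mat_poly A p \<in> carrier_mat n n"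
  by (induction p) (auto simp: mat_poly_pCons)

lemma mat_poly_dim [simp]:
  assumes "A \<in> carrier_mat n n"
  shows "dim_row (mat_poly A p) = n" "dim_col (mat_poly A p) = n"
  using mat_poly_carrier[OF assms] by auto

lemma mat_poly_add:
  assumes A: "A \<in> carrier_mat n n"
  shows "mat_poly A (p + q) = mat_poly A p + mat_poly A q"
proof (induction p q rule: poly_induct2)
  case (pCons a p b q)
  have "A * (mat_poly A p + mat_poly A q) = A * mat_poly A p + A * mat_poly A q"
    by (rule mult_add_distrib_mat[of _ n n _ n]) (use A in auto)
  then show ?case
    using A pCons by (simp add: mat_poly_pCons) (intro eq_matI, auto simp: algebra_simps)
qed (use A in auto)

lemma mat_poly_smult:
  assumes A: "A \<in> carrier_mat n n"
  shows "mat_poly A (Polynomial.smult c p) = c \<cdot>\<^sub>m mat_poly A p"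
proof (induction p)
  case (pCons a p)
  have "A * (c \<cdot>\<^sub>m mat_poly A p) = c \<cdot>\<^sub>m (A * mat_poly A p)"
    by (rule mult_smult_distrib[of _ n n _ n]) (use A in auto)
  then show ?case
    using A pCons by (simp add: mat_poly_pCons) (intro eq_matI, auto simp: algebra_simps)
qed (use A in \<open>auto intro!: eq_matI\<close>)

lemma mat_poly_mult_eigenvector:
  fixes A :: "'a::field mat"
  assumes A: "A \<in> carrier_mat n n" and v: "v \<in> carrier_vec n" "A *\<^sub>v v = x \<cdot>\<^sub>v v"
  shows "mat_poly A p *\<^sub>v v = poly p x \<cdot>\<^sub>v v"
proof (induction p)
  case (pCons a p)
  have "(a \<cdot>\<^sub>m 1\<^sub>m n + A * mat_poly A p) *\<^sub>v v = (a \<cdot>\<^sub>m 1\<^sub>m n) *\<^sub>v v + (A * mat_poly A p) *\<^sub>v v"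
    by (rule add_mult_distrib_mat_vec[of _ n n]) (use A v in auto)
  also have "(A * mat_poly A p) *\<^sub>v v = A *\<^sub>v (mat_poly A p *\<^sub>v v)"
    by (rule assoc_mult_mat_vec[of _ n n _ n]) (use A v in auto)
  also have "\<dots> = poly p x \<cdot>\<^sub>v (x \<cdot>\<^sub>v v)"
    unfolding pCons.IH v(2)[symmetric] using A v(1) by (rule mult_mat_vec)
  also have "(a \<cdot>\<^sub>m 1\<^sub>m n) *\<^sub>v v = a \<cdot>\<^sub>v v"
    using v by (intro eq_vecI) (auto simp: smult_scalar_prod_distrib[of _ n])
  finally show ?case
    using A v by (simp add: mat_poly_pCons) (intro eq_vecI, auto simp: algebra_simps)
qed (use A v in \<open>auto intro!: eq_vecI\<close>)

section \<open>Triangularisation and the spectrum of a polynomial in a matrix\<close>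

lemma similar_mat_wit_mat_poly:
  assumes A: "A \<in> carrier_mat n n" and sim: "similar_mat_wit A B P Q"
  shows "similar_mat_wit (mat_poly A p) (mat_poly B p) P Q"
proof -
  note s = similar_mat_witD2[OF A sim]
  have "mat_poly A p = P * mat_poly B p * Q"
  proof (induction p)
    case (pCons c p)
    define M where "M = mat_poly B p"
    have M: "M \<in> carrier_mat n n" unfolding M_def using s by auto
    note c = s(5-7) M
    have "A * (P * M * Q) = P * B * (Q * P) * M * Q"
      unfolding s(3) using c by (simp add: assoc_mult_mat[of _ n n _ n _ n])
    also have "\<dots> = P * (B * M) * Q"
      using c s(2) by (simp add: assoc_mult_mat[of _ n n _ n _ n])
    finally have 1: "A * (P * M * Q) = P * (B * M) * Q" .
    have "P * (c \<cdot>\<^sub>m 1\<^sub>m n + B * M) * Q = (P * (c \<cdot>\<^sub>m 1\<^sub>m n) + P * (B * M)) * Q"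
      using c by (subst mult_add_distrib_mat[of _ n n _ n]) auto
    also have "\<dots> = P * (c \<cdot>\<^sub>m 1\<^sub>m n) * Q + P * (B * M) * Q"
      using c by (subst add_mult_distrib_mat[of _ n n _ _ n]) auto
    also have "P * (c \<cdot>\<^sub>m 1\<^sub>m n) * Q = c \<cdot>\<^sub>m 1\<^sub>m n"
      using c s(1) by (simp add: mult_smult_distrib[of _ n n _ n] mult_smult_assoc_mat[of _ n n _ n])
    finally have "P * mat_poly B (pCons c p) * Q = c \<cdot>\<^sub>m 1\<^sub>m n + P * (B * M) * Q"
      using s(5) by (simp add: mat_poly_pCons M_def)
    then show ?case
      unfolding mat_poly_pCons[OF A] pCons.IH M_def[symmetric] 1 by simp
  qed (use A s in auto)
  then show ?thesis
    using A s by (auto simp: similar_mat_wit_def Let_def)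
qed

text \<open>On or below the diagonal, a product of upper triangular matrices keeps at most the term
  with \<open>l = i = j\<close>; Horner's scheme then evaluates \<open>p\<close> at each diagonal
  entry.\<close>

lemma mat_poly_upper_triangular:
  assumes B: "B \<in> carrier_mat n n" and ut: "upper_triangular B"
  shows "upper_triangular (mat_poly B p) \<and> (\<forall>i<n. mat_poly B p $$ (i, i) = poly p (B $$ (i, i)))"
proof (induction p)
  case (pCons c p)
  define M where "M = mat_poly B p"
  have M: "M \<in> carrier_mat n n" "upper_triangular M"
    and diag: "\<And>i. i < n \<Longrightarrow> M $$ (i, i) = poly p (B $$ (i, i))"
    using pCons B by (auto simp: M_def)
  have entry: "(B * M) $$ (i, j) = (\<Sum>l<n. B $$ (i, l) * M $$ (l, j))" if "i < n" "j < n" for i j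
    using that B M by (auto simp: scalar_prod_def lessThan_atLeast0)
  have zero: "B $$ (i, l) * M $$ (l, j) = 0" if "i < n" "j < n" "l < n" "j \<le> i" "l \<noteq> i \<or> l \<noteq> j" for i j l
  proof (cases "l < i")
    case True
    then have "B $$ (i, l) = 0" using ut B that by (auto simp: upper_triangular_def)
    then show ?thesis by simp
  next
    case False
    then have "j < l" using that by auto
    then have "M $$ (l, j) = 0" using M that by (auto simp: upper_triangular_def)
    then show ?thesis by simp
  qed
  have low: "(B * M) $$ (i, j) = 0" if "i < n" "j < i" for i j
    unfolding entry[OF that(1) less_trans[OF that(2,1)]]
    by (rule sum.neutral) (use zero[of i j] that in auto)
  have dg: "(B * M) $$ (i, i) = B $$ (i, i) * M $$ (i, i)" if "i < n" for i
    unfolding entry[OF that that] using that zero[of i i]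
    by (subst sum.mono_neutral_right[of _ "{i}"]) auto
  show ?case
    using B M low dg diag unfolding mat_poly_pCons[OF B] M_def[symmetric]
    by (auto simp: upper_triangular_def)
qed (use B in auto)

lemma order_prod_linear:
  "Polynomial.order (x::'a::idom) (\<Prod>e\<leftarrow>es. [:- e, 1:]) = count (mset es) x"
proof -
  have "(\<Prod>e\<leftarrow>es. [:- e, 1:]) \<noteq> (0 :: 'a poly)" for es
    by (induction es) (auto simp del: mult_pCons_left)
  then have "Polynomial.order x ([:- e, 1:] * (\<Prod>e\<leftarrow>es. [:- e, 1:]))
      = (if e = x then 1 else 0) + Polynomial.order x (\<Prod>e\<leftarrow>es. [:- e, 1:])" for e es
    by (subst order_mult) (auto simp: order_linear' simp del: mult_pCons_left)
  then show ?thesis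
    by (induction es) (simp_all del: mult_pCons_left)
qed

text \<open>Schur decomposition makes \<open>A\<close> similar to a triangular matrix with diagonal
  \<open>es\<close>, repetitions included, so algebraic multiplicities are carried along without
  diagonalising \<open>A\<close>.\<close>

lemma char_poly_mat_poly:
  fixes A :: "'a::conjugatable_ordered_field mat"
  assumes A: "A \<in> carrier_mat n n" and cp: "char_poly A = (\<Prod>e\<leftarrow>es. [:- e, 1:])"
  shows "char_poly (mat_poly A p) = (\<Prod>e\<leftarrow>map (poly p) es. [:- e, 1:])"
proof -
  obtain B P Q where "schur_decomposition A es = (B, P, Q)"
    by (cases "schur_decomposition A es") auto
  from schur_decomposition[OF A cp this]
  have sim: "similar_mat_wit A B P Q" and ut: "upper_triangular B" and dg: "diag_mat B = es" by auto
  have B: "B \<in> carrier_mat n n" using similar_mat_witD2[OF A sim] by auto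
  note mp = mat_poly_upper_triangular[OF B ut, of p]
  have "char_poly (mat_poly A p) = char_poly (mat_poly B p)"
    using similar_mat_wit_mat_poly[OF A sim] by (intro char_poly_similar) (auto simp: similar_mat_def)
  also have "\<dots> = (\<Prod>e\<leftarrow>diag_mat (mat_poly B p). [:- e, 1:])"
    using mp B by (intro char_poly_upper_triangular) auto
  also have "diag_mat (mat_poly B p) = map (poly p) es"
    unfolding dg[symmetric] using mp B by (auto simp: diag_mat_def)
  finally show ?thesis .
qed

lemma count_mset_map:
  "count (mset (map f xs)) y = (\<Sum>x \<in> {x \<in> set xs. f x = y}. count (mset xs) x)"
  using count_image_mset[of f "mset xs" y]
  by (simp add: vimage_def Int_def conj_commute)

text \<open>For an eigenvector \<open>v\<close>, the Hermitian form of \<open>A\<close> at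
  \<open>v\<close> equals \<open>x * N\<close> and, by symmetry, also \<open>cnj x * N\<close>,
  where \<open>N\<close> is the squared norm of \<open>v\<close> and nonzero.\<close>

lemma symmetric_real_mat_eigenvalue_real:
  assumes A: "A \<in> carrier_mat n n" and sym: "\<And>i j. i < n \<Longrightarrow> j < n \<Longrightarrow> A $$ (i, j) = A $$ (j, i)"
    and ev: "eigenvalue (map_mat complex_of_real A) x"
  shows "x \<in> \<real>"
proof -
  let ?A = "map_mat complex_of_real A"
  obtain v where v: "v \<in> carrier_vec n" "v \<noteq> 0\<^sub>v n" "?A *\<^sub>v v = x \<cdot>\<^sub>v v"
    using ev A by (auto simp: eigenvalue_def eigenvector_def)
  have row: "(\<Sum>j<n. of_real (A $$ (i, j)) * v $ j) = x * v $ i" if "i < n" for i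
    using arg_cong[OF v(3), of "\<lambda>w. w $ i"] that A v(1)
    by (auto simp: scalar_prod_def lessThan_atLeast0)
  have crow: "(\<Sum>j<n. of_real (A $$ (i, j)) * cnj (v $ j)) = cnj x * cnj (v $ i)" if "i < n" for i
    using arg_cong[OF row[OF that], of cnj] by simp
  define N where "N = (\<Sum>i<n. cnj (v $ i) * v $ i)"
  have "x * N = (\<Sum>i<n. cnj (v $ i) * (\<Sum>j<n. of_real (A $$ (i, j)) * v $ j))"
    by (auto simp: N_def sum_distrib_left[of x] row intro!: sum.cong)
  also have "\<dots> = (\<Sum>i<n. \<Sum>j<n. of_real (A $$ (i, j)) * cnj (v $ i) * v $ j)"
    by (simp add: sum_distrib_left mult_ac)
  also have "\<dots> = (\<Sum>j<n. \<Sum>i<n. of_real (A $$ (i, j)) * cnj (v $ i) * v $ j)"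
    by (rule sum.swap)
  also have "\<dots> = (\<Sum>j<n. v $ j * (\<Sum>i<n. of_real (A $$ (j, i)) * cnj (v $ i)))"
    by (auto simp: sum_distrib_left mult_ac sym intro!: sum.cong)
  also have "\<dots> = cnj x * N"
    by (auto simp: N_def sum_distrib_left[of "cnj x"] crow intro!: sum.cong)
  finally have "(x - cnj x) * N = 0" by (simp add: algebra_simps)
  moreover have "N \<noteq> 0"
  proof
    assume "N = 0"
    then have "complex_of_real (\<Sum>i<n. (norm (v $ i))\<^sup>2) = 0"
      by (simp add: N_def complex_norm_square mult_ac del: of_real_power)
    then have "(\<Sum>i<n. (norm (v $ i))\<^sup>2) = 0" by (simp only: of_real_eq_0_iff)
    then have "\<forall>i<n. v $ i = 0" by (subst (asm) sum_nonneg_eq_0_iff) auto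
    then have "v = 0\<^sub>v n" using v(1) by (intro eq_vecI) auto
    with v(2) show False by simp
  qed
  ultimately have "cnj x = x" by simp
  then show ?thesis by (simp add: Reals_cnj_iff)
qed

lemma symmetric_real_mat_char_poly_splits:
  fixes A :: "real mat"
  assumes A: "A \<in> carrier_mat n n" and sym: "\<And>i j. i < n \<Longrightarrow> j < n \<Longrightarrow> A $$ (i, j) = A $$ (j, i)"
  obtains es where "char_poly A = (\<Prod>e\<leftarrow>es. [:- e, 1:])"
proof -
  interpret p: map_poly_inj_idom_hom complex_of_real ..
  let ?A = "map_mat complex_of_real A"
  have A': "?A \<in> carrier_mat n n" using A by auto
  obtain cs where cs: "char_poly ?A = (\<Prod>c\<leftarrow>cs. [:- c, 1:])"
    using char_poly_factorized[OF A'] by auto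
  have "c \<in> \<real>" if "c \<in> set cs" for c
  proof -
    have "poly (char_poly ?A) c = 0"
      using that unfolding cs by (induction cs) auto
    then have "eigenvalue ?A c" using eigenvalue_root_char_poly[OF A'] by simp
    from symmetric_real_mat_eigenvalue_real[OF A sym this] show ?thesis by simp
  qed
  then have "map complex_of_real (map Re cs) = cs"
    by (induction cs) auto
  then have "map_poly complex_of_real (char_poly A) = (\<Prod>c\<leftarrow>map complex_of_real (map Re cs). [:- c, 1:])"
    by (simp only: cs[symmetric] of_real_hom.char_poly_hom[OF A])
  also have "\<dots> = map_poly complex_of_real (\<Prod>c\<leftarrow>map Re cs. [:- c, 1:])"
    by (induction cs) (simp_all add: p.hom_mult del: mult_pCons_left map_map)
  finally have "char_poly A = (\<Prod>c\<leftarrow>map Re cs. [:- c, 1:])"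
    by (simp only: p.eq_iff)
  with that show thesis by blast
qed

text \<open>The eigenvalue list of the new matrix is the image under \<open>p\<close> of that of
  \<open>A\<close>, so eigenvalues with the same image pool their multiplicities. Equal
  multiplicities thus come down to injectivity of \<open>p\<close> on the spectrum.\<close>

lemma multiplicity_mat_poly:
  fixes A :: "real mat"
  assumes A: "A \<in> carrier_mat n n" and sym: "\<And>i j. i < n \<Longrightarrow> j < n \<Longrightarrow> A $$ (i, j) = A $$ (j, i)"
  shows "multiplicity_of (mat_poly A p) y
    = (\<Sum>m \<in> {m. eigenvalue A m \<and> poly p m = y}. multiplicity_of A m)"
proof -
  obtain es where es: "char_poly A = (\<Prod>e\<leftarrow>es. [:- e, 1:])"
    using symmetric_real_mat_char_poly_splits[OF A sym] by metis
  have "poly (char_poly A) m = 0 \<longleftrightarrow> m \<in> set es" for m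
    unfolding es by (induction es) auto
  then have "{m. eigenvalue A m \<and> poly p m = y} = {m \<in> set es. poly p m = y}"
    using eigenvalue_root_char_poly[OF A] by auto
  then show ?thesis
    by (simp add: multiplicity_of_def char_poly_mat_poly[OF A es] es order_prod_linear count_mset_map
      del: map_map mset_map)
qed

declare a_coeff.simps [simp del]

section \<open>The distance polynomials\<close>

text \<open>The case \<open>j = 0\<close> is separate because \<open>a_coeff k i 0\<close> is only
  the seed for the next column of the recursion; the leading coefficient is 1.\<close>

definition F_coeff :: "nat \<Rightarrow> nat \<Rightarrow> nat \<Rightarrow> real" where
  "F_coeff k i j = (if j = 0 then 1 else (-1) ^ j * (real k - 1) ^ (j - 1) * a_coeff k i j)"

text \<open>For \<open>i < d\<close> this is the polynomial of the distance-\<open>i\<close> matrix, for \<open>i = d\<close> that of \<open>k\<close> times it.\<close>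

definition F_poly :: "nat \<Rightarrow> nat \<Rightarrow> real poly" where
  "F_poly k i = (\<Sum>j\<le>i div 2. monom (F_coeff k i j) (i - 2 * j))"

lemma F_coeff_eq_0: "i div 2 < j \<Longrightarrow> F_coeff k i j = 0"
  by (cases j) (auto simp: F_coeff_def a_coeff.simps(2))

lemma F_poly_eq: "i div 2 \<le> m \<Longrightarrow> F_poly k i = (\<Sum>j\<le>m. monom (F_coeff k i j) (i - 2 * j))"
  unfolding F_poly_def by (rule sum.mono_neutral_left) (auto simp: F_coeff_eq_0)

lemma F_poly_0 [simp]: "F_poly k 0 = 1"
  by (simp add: F_poly_def F_coeff_def)

lemma F_poly_1 [simp]: "F_poly k (Suc 0) = [:0, 1:]"
  by (simp add: F_poly_def F_coeff_def monom_Suc)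

text \<open>For \<open>j = 0\<close> the factor is the seed \<open>a_coeff k i 0\<close>, which is
  \<open>k\<close> at \<open>i = 0\<close> and \<open>k - 1\<close> otherwise; for
  \<open>j > 0\<close> it is the extra power of \<open>k - 1\<close>, and then \<open>i = 0\<close>
  cannot occur.\<close>

lemma F_coeff_rec:
  assumes "Suc j \<le> (i + 2) div 2"
  shows "F_coeff k (i + 2) (Suc j)
    = F_coeff k (i + 1) (Suc j) - (if i = 0 then real k else real k - 1) * F_coeff k i j"
proof (cases j)
  case 0
  have "a_coeff k (i + 2) (Suc 0) = a_coeff k (i + 1) (Suc 0) + a_coeff k i 0"
    using a_coeff.simps(2)[of k "i + 2" 0] by simp
  with 0 show ?thesis by (simp add: F_coeff_def a_coeff.simps(1))
next
  case (Suc l)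
  then have "i \<noteq> 0" using assms by auto
  moreover have "a_coeff k (i + 2) (Suc j) = a_coeff k (i + 1) (Suc j) + a_coeff k i j"
    using assms a_coeff.simps(2)[of k "i + 2" j] by simp
  ultimately show ?thesis using Suc by (simp add: F_coeff_def algebra_simps)
qed

lemma pCons_0_sum: "pCons 0 (\<Sum>j\<in>A. p j) = (\<Sum>j\<in>A. pCons 0 (p j))"
  by (induction A rule: infinite_finite_induct) (simp_all, metis add_pCons add_0)

text \<open>This mirrors the step between distance matrices: a vertex at distance \<open>i\<close>
  has \<open>k\<close> or \<open>k - 1\<close> neighbours one farther away, according as
  \<open>i = 0\<close> or not.\<close>

lemma F_poly_Suc_Suc:
  "F_poly k (i + 2) = pCons 0 (F_poly k (i + 1))
    - Polynomial.smult (if i = 0 then real k else real k - 1) (F_poly k i)"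
proof -
  define r where "r = (if i = 0 then real k else real k - 1)"
  have 1: "pCons 0 (F_poly k (i + 1)) = (\<Sum>j\<le>Suc i. monom (F_coeff k (i + 1) j) (i + 2 - 2 * j))"
  proof -
    have e: "F_poly k (i + 1) = (\<Sum>j\<le>Suc i. monom (F_coeff k (i + 1) j) (i + 1 - 2 * j))"
      by (rule F_poly_eq) simp
    have "pCons 0 (F_poly k (i + 1)) = (\<Sum>j\<le>Suc i. pCons 0 (monom (F_coeff k (i + 1) j) (i + 1 - 2 * j)))"
      unfolding e by (rule pCons_0_sum)
    also have "\<dots> = (\<Sum>j\<le>Suc i. monom (F_coeff k (i + 1) j) (i + 2 - 2 * j))"
    proof (intro sum.cong refl)
      fix j
      \<comment> \<open>Once \<open>2 * j\<close> exceeds \<open>i + 1\<close>, subtraction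
        truncates and the exponents disagree, but the coefficient is 0 there.\<close>
      show "pCons 0 (monom (F_coeff k (i + 1) j) (i + 1 - 2 * j)) = monom (F_coeff k (i + 1) j) (i + 2 - 2 * j)"
      proof (cases "2 * j \<le> i + 1")
        case True
        then have "i + 2 - 2 * j = Suc (i + 1 - 2 * j)" by simp
        then show ?thesis by (simp add: monom_Suc)
      qed (simp add: F_coeff_eq_0)
    qed
    finally show ?thesis .
  qed
  have 2: "Polynomial.smult r (F_poly k i) = (\<Sum>j\<le>i. monom (r * F_coeff k i j) (i + 2 - 2 * Suc j))"
    unfolding F_poly_eq[of i i, simplified] by (simp add: smult_sum2 smult_monom)
  have "F_poly k (i + 2) = (\<Sum>j\<le>Suc i. monom (F_coeff k (i + 2) j) (i + 2 - 2 * j))"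
    by (rule F_poly_eq) simp
  also have "\<dots> = monom 1 (i + 2) + (\<Sum>j\<le>i. monom (F_coeff k (i + 2) (Suc j)) (i + 2 - 2 * Suc j))"
    by (subst sum.atMost_Suc_shift) (simp add: F_coeff_def)
  also have "(\<Sum>j\<le>i. monom (F_coeff k (i + 2) (Suc j)) (i + 2 - 2 * Suc j)) =
      (\<Sum>j\<le>i. monom (F_coeff k (i + 1) (Suc j)) (i + 2 - 2 * Suc j) - monom (r * F_coeff k i j) (i + 2 - 2 * Suc j))"
  proof (intro sum.cong refl)
    fix j
    show "monom (F_coeff k (i + 2) (Suc j)) (i + 2 - 2 * Suc j) =
      monom (F_coeff k (i + 1) (Suc j)) (i + 2 - 2 * Suc j) - monom (r * F_coeff k i j) (i + 2 - 2 * Suc j)"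
    proof (cases "Suc j \<le> (i + 2) div 2")
      case True
      then show ?thesis by (simp only: F_coeff_rec r_def diff_monom)
    qed (simp add: F_coeff_eq_0)
  qed
  also have "monom 1 (i + 2) + \<dots> = (\<Sum>j\<le>Suc i. monom (F_coeff k (i + 1) j) (i + 2 - 2 * j))
      - (\<Sum>j\<le>i. monom (r * F_coeff k i j) (i + 2 - 2 * Suc j))"
  proof -
    have "(\<Sum>j\<le>Suc i. monom (F_coeff k (i + 1) j) (i + 2 - 2 * j)) = monom 1 (i + 2)
        + (\<Sum>j\<le>i. monom (F_coeff k (i + 1) (Suc j)) (i + 2 - 2 * Suc j))"
      by (subst sum.atMost_Suc_shift) (simp add: F_coeff_def)
    then show ?thesis by (simp only: sum_subtractf add_diff_eq)
  qed
  finally show ?thesis unfolding 1 r_def[symmetric] 2 .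
qed

lemma poly_F_poly_Suc_Suc:
  "poly (F_poly k (i + 2)) x = x * poly (F_poly k (i + 1)) x
    - (if i = 0 then real k else real k - 1) * poly (F_poly k i) x"
  by (simp only: F_poly_Suc_Suc) simp

text \<open>The coefficient of degree \<open>m\<close> collects the contributions of all
  \<open>F_poly k (m + 2 * j)\<close> with index below \<open>d\<close>, so exchanging the order of
  summation regroups \<open>dist_poly\<close> by distance.\<close>

lemma dist_poly_even:
  assumes g: "g = 2 * d"
  shows "dist_poly k g = (\<Sum>i<d. Polynomial.smult (real i) (F_poly k i)) + Polynomial.smult (real d / real k) (F_poly k d)"
proof -
  have le_div_2: "j \<le> m div 2 \<longleftrightarrow> 2 * j \<le> m" for j m :: nat by presburger
  have "monom (real m + (\<Sum>j = 1..(d - m - 1) div 2. (-1) ^ j * real (m + 2 * j) * (real k - 1) ^ (j - 1) * a_coeff k (m + 2 * j) j)) m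
      = (\<Sum>j\<le>(d - m - 1) div 2. monom (real (m + 2 * j) * F_coeff k (m + 2 * j) j) m)" (is "?l = _") for m
  proof -
    have "?l = monom (real m) m + (\<Sum>j = 1..(d - m - 1) div 2. monom (real (m + 2 * j) * F_coeff k (m + 2 * j) j) m)"
      unfolding add_monom[symmetric] monom_sum
      by (intro arg_cong2[of _ _ _ _ "(+)"] sum.cong refl) (auto simp: F_coeff_def)
    also have "monom (real m) m = monom (real (m + 2 * 0) * F_coeff k (m + 2 * 0) 0) m"
      by (simp add: F_coeff_def)
    also have "\<dots> + (\<Sum>j = 1..(d - m - 1) div 2. monom (real (m + 2 * j) * F_coeff k (m + 2 * j) j) m)
        = (\<Sum>j\<le>(d - m - 1) div 2. monom (real (m + 2 * j) * F_coeff k (m + 2 * j) j) m)"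
      by (simp add: atMost_atLeast0 sum.atLeast_Suc_atMost)
    finally show ?thesis .
  qed
  then have "(\<Sum>m<d. monom (real m + (\<Sum>j = 1..(d - m - 1) div 2. (-1) ^ j * real (m + 2 * j) * (real k - 1) ^ (j - 1) * a_coeff k (m + 2 * j) j)) m)
      = (\<Sum>(m, j)\<in>Sigma {..<d} (\<lambda>m. {..(d - m - 1) div 2}). monom (real (m + 2 * j) * F_coeff k (m + 2 * j) j) m)"
    by (simp add: sum.Sigma)
  also have "\<dots> = (\<Sum>(i, j)\<in>Sigma {..<d} (\<lambda>i. {..i div 2}). monom (real i * F_coeff k i j) (i - 2 * j))"
    by (rule sum.reindex_bij_witness[where i = "\<lambda>(i, j). (i - 2 * j, j)" and j = "\<lambda>(m, j). (m + 2 * j, j)"]) (auto simp: le_div_2)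
  also have "\<dots> = (\<Sum>i<d. Polynomial.smult (real i) (F_poly k i))"
    by (simp add: sum.Sigma[symmetric] F_poly_def smult_sum2 smult_monom)
  finally have 1: "(\<Sum>m<d. monom (real m + (\<Sum>j = 1..(d - m - 1) div 2. (-1) ^ j * real (m + 2 * j) * (real k - 1) ^ (j - 1) * a_coeff k (m + 2 * j) j)) m)
      = (\<Sum>i<d. Polynomial.smult (real i) (F_poly k i))" .
  have "F_poly k d = monom 1 d + (\<Sum>i = 1..d div 2. monom ((-1) ^ i * (real k - 1) ^ (i - 1) * a_coeff k d i) (d - 2 * i))"
    by (simp add: F_poly_def F_coeff_def atMost_atLeast0 sum.atLeast_Suc_atMost)
  with 1 show ?thesis
    unfolding dist_poly_def Let_def using assms by simp
qed

text \<open>The form \<open>b\<^sup>2 - x * a * b + q * a\<^sup>2\<close> with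
  \<open>q = real k - 1\<close> is multiplied by \<open>q\<close> under the step from
  \<open>(a, b)\<close> to \<open>(b, x * b - q * a)\<close>. It starts at index 1, since the first
  step of the recurrence has \<open>k\<close> in place of \<open>q\<close>.\<close>

lemma F_poly_invariant:
  "(poly (F_poly k (i + 2)) x)\<^sup>2 - x * poly (F_poly k (i + 1)) x * poly (F_poly k (i + 2)) x
      + (real k - 1) * (poly (F_poly k (i + 1)) x)\<^sup>2 = (real k - 1) ^ i * ((real k)\<^sup>2 - x\<^sup>2)"
proof (induction i)
  case 0
  have "poly (F_poly k (0 + 2)) x = x * x - k"
    using poly_F_poly_Suc_Suc[of k 0 x] by simp
  then show ?case unfolding \<open>_ = x * x - _\<close> by (simp add: algebra_simps power2_eq_square)
next
  case (Suc i)
  define a b q where "a = poly (F_poly k (i + 1)) x" and "b = poly (F_poly k (i + 2)) x" and "q = real k - 1"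
  have c: "poly (F_poly k (Suc i + 2)) x = x * b - q * a"
    using poly_F_poly_Suc_Suc[of k "Suc i" x] by (simp add: a_def b_def q_def)
  have "(x * b - q * a)\<^sup>2 - x * b * (x * b - q * a) + q * b\<^sup>2 = q * (b\<^sup>2 - x * a * b + q * a\<^sup>2)"
    by (simp add: algebra_simps power2_eq_square)
  also have "\<dots> = q * (q ^ i * ((real k)\<^sup>2 - x\<^sup>2))"
    using Suc by (simp add: a_def b_def q_def)
  finally show ?case unfolding c by (simp add: b_def q_def)
qed

text \<open>At this point the recurrence has the characteristic roots -1 and
  \<open>- (real k - 1)\<close>, and the initial values select the second.\<close>

lemma poly_F_poly_neg_degree:
  "poly (F_poly k (Suc i)) (- real k) = (-1) ^ Suc i * real k * (real k - 1) ^ i"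
proof (induction i rule: less_induct)
  case (less i)
  consider "i = 0" | "i = 1" | j where "i = j + 2" by (metis add_2_eq_Suc' not0_implies_Suc One_nat_def)
  then show ?case
  proof cases
    case 2
    then show ?thesis using poly_F_poly_Suc_Suc[of k 0 "- real k"] by (simp add: algebra_simps)
  next
    case (3 j)
    have "poly (F_poly k (Suc j + 2)) (- real k)
        = - k * poly (F_poly k (Suc (j + 1))) (- real k) - (real k - 1) * poly (F_poly k (Suc j)) (- real k)"
      using poly_F_poly_Suc_Suc[of k "Suc j" "- real k"] by simp
    also have "\<dots> = (-1) ^ (j + 3) * real k * (real k - 1) ^ (j + 2)"
    proof -
      have "poly (F_poly k (Suc j)) (- real k) = (-1) ^ Suc j * real k * (real k - 1) ^ j"
        "poly (F_poly k (Suc (j + 1))) (- real k) = (-1) ^ Suc (j + 1) * real k * (real k - 1) ^ (j + 1)"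
        by (rule less; use 3 in simp)+
      then show ?thesis unfolding \<open>_ = (-1) ^ Suc j * _ * _\<close> \<open>_ = (-1) ^ Suc (j + 1) * _ * _\<close>
        by (simp add: algebra_simps power_add)
    qed
    finally show ?thesis using 3 by (simp add: numeral_3_eq_3)
  qed simp
qed

text \<open>The hypothesis \<open>rel\<close> is the boundary condition that eigenvalues satisfy at
  diameter \<open>i + 2\<close>. After scaling the invariant by \<open>q * (real k)\<^sup>2\<close>
  it eliminates \<open>a\<close>, and the common factor \<open>(real k)\<^sup>2 - x\<^sup>2\<close>
  cancels.\<close>

lemma F_poly_square:
  assumes k: "2 \<le> k" and x: "x\<^sup>2 \<noteq> (real k)\<^sup>2"
    and rel: "x * poly (F_poly k (i + 2)) x = (real k - 1) * k * poly (F_poly k (i + 1)) x"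
  shows "(poly (F_poly k (i + 2)) x)\<^sup>2 = (real k)\<^sup>2 * (real k - 1) ^ i"
proof -
  define a b q where "a = poly (F_poly k (i + 1)) x" and "b = poly (F_poly k (i + 2)) x" and "q = real k - 1"
  have q: "q > 0" and kq: "real k = q + 1" using k by (auto simp: q_def)
  have rel': "x * b = q * k * a" using rel by (simp add: a_def b_def q_def)
  have inv: "b\<^sup>2 - x * a * b + q * a\<^sup>2 = q ^ i * ((real k)\<^sup>2 - x\<^sup>2)"
    using F_poly_invariant[of k i x] by (simp add: a_def b_def q_def)
  have "q * (real k)\<^sup>2 * (b\<^sup>2 - x * a * b + q * a\<^sup>2)
      = q * (real k)\<^sup>2 * b\<^sup>2 - x * b * real k * (q * k * a) + (q * k * a) * (q * k * a)"
    by (simp add: algebra_simps power2_eq_square)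
  also have "\<dots> = q * b\<^sup>2 * ((real k)\<^sup>2 - x\<^sup>2)"
    by (simp only: rel'[symmetric]) (simp add: kq algebra_simps power2_eq_square)
  finally have "q * ((real k)\<^sup>2 - x\<^sup>2) * (b\<^sup>2 - (real k)\<^sup>2 * q ^ i) = 0"
    unfolding inv by (simp add: algebra_simps)
  then have "b\<^sup>2 = (real k)\<^sup>2 * q ^ i" using q x by simp
  then show ?thesis by (simp add: b_def q_def)
qed

section \<open>Arithmetic of the eigenvalues\<close>

text \<open>The characteristic polynomial is monic with integer coefficients, so eigenvalues are
  algebraic integers and its roots are stable under changing the sign of an irrational square
  root.\<close>

lemma int_mat_eigenvalue:
  fixes A :: "real mat"
  assumes A: "A \<in> carrier_mat n n" and int: "\<And>i j. i < n \<Longrightarrow> j < n \<Longrightarrow> A $$ (i, j) \<in> \<int>"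
    and ev: "eigenvalue A x"
  shows "x \<in> \<rat> \<Longrightarrow> x \<in> \<int>"
    and "\<lbrakk>x = a + b * sqrt (real m); a \<in> \<rat>; b \<in> \<rat>; sqrt (real m) \<notin> \<rat>\<rbrakk> \<Longrightarrow> eigenvalue A (a - b * sqrt (real m))"
proof -
  define B where "B = map_mat floor A"
  have B: "B \<in> carrier_mat n n" using A by (simp add: B_def)
  have AB: "A = map_mat real_of_int B"
    using A int by (intro eq_matI) (auto simp: B_def elim!: Ints_cases)
  define p where "p = char_poly B"
  have cp: "char_poly A = map_poly real_of_int p"
    unfolding AB p_def by (rule of_int_hom.char_poly_hom[OF B])
  have root: "eigenvalue A y \<longleftrightarrow> poly (map_poly real_of_int p) y = 0" for y
    using eigenvalue_root_char_poly[OF A] cp by simp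
  have "lead_coeff p = 1" using degree_monic_char_poly[OF B] by (simp add: p_def)
  then have "algebraic_int x"
    using ev root by (auto simp: algebraic_int_altdef_ipoly)
  then show "x \<in> \<rat> \<Longrightarrow> x \<in> \<int>" by (rule rational_algebraic_int_is_int)
  assume x: "x = a + b * sqrt (real m)" and ab: "a \<in> \<rat>" "b \<in> \<rat>" and irr: "sqrt (real m) \<notin> \<rat>"
  define s where "s = sqrt (real m)"
  have ss: "s * s = real m" by (simp add: s_def)
  \<comment> \<open>Horner's scheme preserves conjugate pairs \<open>c + e * s\<close>,
    \<open>c - e * s\<close> with rational \<open>c\<close> and \<open>e\<close>.\<close>
  have "\<exists>c\<in>\<rat>. \<exists>e\<in>\<rat>. poly (map_poly real_of_int r) (a + b * s) = c + e * s
      \<and> poly (map_poly real_of_int r) (a - b * s) = c - e * s" for r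
  proof (induction r)
    case 0
    show ?case by (rule bexI[of _ 0], rule bexI[of _ 0]) auto
  next
    case (pCons z r)
    then obtain c e where ce: "c \<in> \<rat>" "e \<in> \<rat>" "poly (map_poly real_of_int r) (a + b * s) = c + e * s"
      "poly (map_poly real_of_int r) (a - b * s) = c - e * s" by auto
    have step: "poly (map_poly real_of_int (pCons z r)) y = of_int z + y * poly (map_poly real_of_int r) y" for y
      by (simp add: of_int_hom.map_poly_pCons_hom)
    have b2: "b * s * (e * s) = b * e * m" using ss by (simp add: algebra_simps)
    show ?case unfolding step ce
      by (rule bexI[of _ "of_int z + a * c + b * e * m"], rule bexI[of _ "a * e + b * c"])
        (use b2 ab ce(1,2) in \<open>auto simp: algebra_simps\<close>)
  qed
  then obtain c e where ce: "c \<in> \<rat>" "e \<in> \<rat>" "poly (map_poly real_of_int p) (a + b * s) = c + e * s"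
    "poly (map_poly real_of_int p) (a - b * s) = c - e * s" by blast
  have zero: "c + e * s = 0" using ce(3) ev root x by (simp add: s_def)
  have "e = 0"
  proof (rule ccontr)
    assume "e \<noteq> 0"
    then have "s = - c / e" using zero by (simp add: field_simps)
    then show False using ce irr by (auto simp: s_def)
  qed
  then have "poly (map_poly real_of_int p) (a - b * s) = 0" using zero ce(4) by simp
  then show "eigenvalue A (a - b * sqrt (real m))" using root by (simp add: s_def)
qed

text \<open>If \<open>u = w\<close>, subtract the equations. If \<open>u = - w\<close>, the product
  of the right sides is \<open>4 - 4 * Q < 0\<close>, while that of the left sides is
  nonnegative.\<close>

lemma eigenvalue_eq_if_square_eq:
  fixes k x y P u w Q :: real
  assumes "x < k" "y < k" and u: "(k - x) * P = 2 * u - 2" and w: "(k - y) * P = 2 * w - 2"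
    and sq: "u\<^sup>2 = Q" "w\<^sup>2 = Q" and "1 < Q"
  shows "x = y"
proof -
  consider "u = w" | "u = - w" using sq by (metis power2_eq_iff)
  then show ?thesis
  proof cases
    case 1
    then have "(x - y) * P = 0" using u w by (simp add: algebra_simps)
    moreover have "P \<noteq> 0" using u sq \<open>1 < Q\<close> by auto
    ultimately show ?thesis by simp
  next
    case 2
    have "0 \<le> (k - x) * (k - y) * P\<^sup>2" using assms by simp
    also have "\<dots> = (2 * u - 2) * (2 * w - 2)" unfolding u[symmetric] w[symmetric] by (simp add: power2_eq_square)
    also have "\<dots> = 4 - 4 * Q" unfolding sq(2)[symmetric] 2 by (simp add: power2_eq_square algebra_simps)
    finally show ?thesis using \<open>1 < Q\<close> by simp
  qed
qed

text \<open>Size and parity leave only \<open>q = 2\<close> with \<open>q ^ e = 4\<close>, where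
  \<open>t * 5 = 6\<close> has no integer solution.\<close>

lemma int_times_power_Suc_neq:
  fixes t :: int and q e :: nat
  assumes "0 < t" "2 \<le> q" "2 \<le> e"
  shows "t * (int q ^ e + 1) \<noteq> 2 * (int q + 1)"
proof
  assume eq: "t * (int q ^ e + 1) = 2 * (int q + 1)"
  have "int q ^ 2 \<le> int q ^ e" using assms by (intro power_increasing) auto
  moreover have "1 * (int q ^ e + 1) \<le> t * (int q ^ e + 1)" using assms by (intro mult_right_mono) auto
  ultimately have le: "int q ^ 2 \<le> 2 * int q + 1" "int q ^ e + 1 \<le> 2 * (int q + 1)" "int q ^ 2 \<le> int q ^ e"
    using eq by simp_all
  have "q < 3"
  proof (rule ccontr)
    assume "\<not> q < 3"
    then have "3 * int q \<le> int q ^ 2" by (simp add: power2_eq_square)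
    then show False using le(1) \<open>\<not> q < 3\<close> by linarith
  qed
  then have q: "q = 2" using assms by simp
  have "X = 4" if "even X" "X \<le> 5" "4 \<le> X" for X :: int using that by presburger
  moreover have "even ((2::int) ^ e)" "(2::int) ^ e \<le> 5" "4 \<le> (2::int) ^ e"
    using le(2,3) assms(3) unfolding q by simp_all
  ultimately have "(2::int) ^ e = 4" by blast
  then have "t * 5 = 6" using eq unfolding q by simp
  then show False by presburger
qed

text \<open>Here \<open>P\<close> stands for a common value at \<open>y\<close> and at minus the
  degree, for diameter \<open>2 * e\<close>. It is positive, which forces \<open>w = Q\<close>;
  cancelling \<open>Q - 1\<close> makes \<open>y\<close> rational, hence an integer, and
  \<open>int_times_power_Suc_neq\<close> applies.\<close>

lemma no_collision_with_neg_degree_even: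
  fixes q e :: nat and y P w :: real
  assumes q: "2 \<le> q" and e: "2 \<le> e" and y: "y < real q + 1"
    and P: "(real q + 1) * P = real q ^ (2 * e) - 1"
    and w: "(real q + 1 - y) * P = 2 * w - 2" "w\<^sup>2 = real q ^ (2 * e)"
    and int: "y \<in> \<rat> \<Longrightarrow> y \<in> \<int>"
  shows False
proof -
  define Q where "Q = real q ^ e"
  have Q: "1 < Q" using q e unfolding Q_def by (intro one_less_power) auto
  have Q2: "real q ^ (2 * e) = Q\<^sup>2" by (simp add: Q_def power_even_eq)
  have "0 < (real q + 1) * P" unfolding P Q2 using Q by (simp add: one_less_power)
  then have "0 < P" by (simp add: zero_less_mult_iff)
  then have "1 < w" using w(1) y by (smt (verit) mult_pos_pos)
  then have "w = Q" using w(2) Q unfolding Q2 by (simp add: power2_eq_iff)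
  have "(real q + 1 - y) * ((Q + 1) * (Q - 1)) = (real q + 1 - y) * ((real q + 1) * P)"
    unfolding P Q2 by (simp add: algebra_simps power2_eq_square)
  also have "\<dots> = (real q + 1) * (2 * w - 2)" by (simp add: w(1)[symmetric])
  finally have "((real q + 1 - y) * (Q + 1) - 2 * (real q + 1)) * (Q - 1) = 0"
    unfolding \<open>w = Q\<close> by (simp add: algebra_simps)
  then have eq: "(real q + 1 - y) * (Q + 1) = 2 * (real q + 1)" using Q by simp
  then have "y = real q + 1 - 2 * (real q + 1) / (Q + 1)" using Q by (simp add: field_simps)
  also have "\<dots> \<in> \<rat>" by (simp add: Q_def)
  finally obtain z where z: "y = of_int z" using int by (auto elim: Ints_cases)
  have "of_int ((int q + 1 - z) * (int q ^ e + 1)) = (of_int (2 * (int q + 1)) :: real)"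
    using eq by (simp add: z Q_def)
  then have "(int q + 1 - z) * (int q ^ e + 1) = 2 * (int q + 1)" by (simp only: of_int_eq_iff)
  moreover have "0 < int q + 1 - z" using y unfolding z by linarith
  ultimately show False using int_times_power_Suc_neq q e by blast
qed

text \<open>For \<open>r \<ge> 3\<close> the bound \<open>3 * (int r)\<^sup>2 \<le> R\<close> makes
  the right side smaller than \<open>R\<^sup>2\<close>. For \<open>r = 2\<close> this holds from
  \<open>R = 32\<close> on, and \<open>R = 8\<close> is excluded since 65 does not divide
  90.\<close>

lemma int_times_power_Suc_neq_odd:
  fixes t :: int and r e :: nat
  assumes t: "0 < t" and r: "2 \<le> r" and e: "1 \<le> e"
  defines "R \<equiv> int r ^ (2 * e + 1)"
  shows "t * (R\<^sup>2 + 1) \<noteq> 2 * ((int r)\<^sup>2 + 1) * (R + 1)"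
proof
  assume eq: "t * (R\<^sup>2 + 1) = 2 * ((int r)\<^sup>2 + 1) * (R + 1)"
  have Rpos: "0 < R" unfolding R_def using r by simp
  have "1 * (R\<^sup>2 + 1) \<le> t * (R\<^sup>2 + 1)" using t by (intro mult_right_mono) auto
  then have le: "R\<^sup>2 + 1 \<le> 2 * ((int r)\<^sup>2 + 1) * (R + 1)" using eq by simp
  show False
  proof (cases "r = 2")
    case True
    show False
    proof (cases "e = 1")
      case e1: True
      then have "R = 8" using True by (simp add: R_def)
      then have "t * 65 = 90" using eq True by simp
      then show False by presburger
    next
      case False
      then have "(2::int) ^ 5 \<le> 2 ^ (2 * e + 1)" using e by (intro power_increasing) auto
      then have "32 \<le> R" using True by (simp add: R_def)
      then have "32 * R \<le> R\<^sup>2" by (simp add: power2_eq_square)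
      then show False using le True \<open>32 \<le> R\<close> by simp
    qed
  next
    case False
    then have r3: "3 \<le> int r" using r by simp
    have "int r ^ 3 \<le> R" unfolding R_def using r e by (intro power_increasing) auto
    moreover have "3 * (int r)\<^sup>2 \<le> int r ^ 3" using mult_right_mono[OF r3, of "(int r)\<^sup>2"]
      by (simp add: power2_eq_square power3_eq_cube)
    moreover have "9 \<le> (int r)\<^sup>2" using power_mono[OF r3, of 2] by simp
    ultimately have R: "3 * (int r)\<^sup>2 \<le> R" "27 \<le> R" by linarith+
    have "3 * (R\<^sup>2 + 1) \<le> 2 * (3 * (int r)\<^sup>2 + 3) * (R + 1)" using le by (simp add: algebra_simps)
    also have "\<dots> \<le> 2 * (R + 3) * (R + 1)" using R by (intro mult_right_mono mult_left_mono) auto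
    finally have "R * R \<le> 8 * R + 3" by (simp add: algebra_simps power2_eq_square)
    moreover have "27 * R \<le> R * R" using R by (intro mult_right_mono) auto
    ultimately show False using R by linarith
  qed
qed

text \<open>
  The equations force \<open>y = a + b \<surd>q\<close> with \<open>a\<close>, \<open>b\<close> rational and \<open>b < 0\<close>. If \<open>\<surd>q\<close> is
  irrational then the conjugate \<open>a - b \<surd>q\<close> exceeds the degree \<open>q + 1\<close>; otherwise \<open>y\<close> is an
  integer, and divisibility rules that out.
\<close>

lemma no_collision_with_neg_degree_odd:
  fixes q e :: nat and y P w :: real
  assumes q: "1 \<le> q" and e: "1 \<le> e" and y: "y < real q + 1" "y \<noteq> - (real q + 1)"
    and P: "(real q + 1) * P = - (real q ^ (2 * e + 1)) - 1"
    and w: "(real q + 1 - y) * P = 2 * w - 2" "w\<^sup>2 = real q ^ (2 * e + 1)"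
    and int: "y \<in> \<rat> \<Longrightarrow> y \<in> \<int>"
    and conj: "\<And>a b. \<lbrakk>y = a + b * sqrt (real q); a \<in> \<rat>; b \<in> \<rat>; sqrt (real q) \<notin> \<rat>\<rbrakk> \<Longrightarrow> a - b * sqrt (real q) \<le> real q + 1"
    and sqrt_int: "sqrt (real q) \<in> \<rat> \<Longrightarrow> sqrt (real q) \<in> \<int>"
  shows False
proof -
  define s where "s = sqrt (real q)"
  define N where "N = real q ^ (2 * e + 1)"
  define S where "S = s * real q ^ e"
  have ss: "s * s = real q" and s1: "1 \<le> s" using q by (auto simp: s_def)
  have qe: "1 \<le> real q ^ e" using q by (intro one_le_power) simp
  have "1 * 1 \<le> s * real q ^ e" using s1 qe by (intro mult_mono) auto
  then have S1: "1 \<le> S" by (simp add: S_def)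
  have SN: "S\<^sup>2 = N"
  proof -
    have "S\<^sup>2 = (s * s) * (real q ^ e * real q ^ e)" by (simp add: S_def power2_eq_square)
    also have "\<dots> = N" unfolding ss N_def by (simp add: power_add mult_2)
    finally show ?thesis .
  qed
  then have N1: "1 \<le> N" using S1 one_le_power[of S 2] by simp
  \<comment> \<open>For odd diameter the value at minus the degree is negative, so \<open>w\<close>
    is the negative root \<open>- S\<close>.\<close>
  have "(real q + 1) * P < 0" unfolding P using N1 by (simp add: N_def)
  then have "P < 0" by (simp add: mult_less_0_iff)
  then have "w < 1" using w(1) y(1) by (smt (verit) mult_pos_neg)
  then have wS: "w = - S" using w(2) S1 SN unfolding N_def[symmetric] by (metis not_le power2_eq_iff)
  have eq: "(real q + 1 - y) * (N + 1) = 2 * (real q + 1) * (S + 1)"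
  proof -
    have "(real q + 1 - y) * (N + 1) = - ((real q + 1 - y) * ((real q + 1) * P))"
      unfolding P N_def by (simp add: algebra_simps)
    also have "\<dots> = - ((real q + 1) * (2 * w - 2))" by (simp add: w(1)[symmetric])
    finally show ?thesis unfolding wS by (simp add: algebra_simps)
  qed
  have yeq: "y = real q + 1 - 2 * (real q + 1) * (S + 1) / (N + 1)"
    using eq N1 by (simp add: field_simps)
  show False
  proof (cases "s \<in> \<rat>")
    case False
    define a b where "a = real q + 1 - 2 * (real q + 1) / (N + 1)"
      and "b = - (2 * (real q + 1) * real q ^ e / (N + 1))"
    have "y = a + b * sqrt (real q)"
      unfolding yeq a_def b_def S_def s_def[symmetric] by (simp add: add_divide_distrib[symmetric] algebra_simps diff_divide_distrib)
    moreover have "a \<in> \<rat>" "b \<in> \<rat>" by (auto simp: a_def b_def N_def)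
    ultimately have "a - b * s \<le> real q + 1" using conj False by (simp add: s_def)
    \<comment> \<open>The conjugate lies above \<open>real q + 1\<close> unless
      \<open>S \<le> 1\<close>, which would make \<open>s\<close> equal to 1.\<close>
    moreover have "a - b * s = real q + 1 + 2 * (real q + 1) * (S - 1) / (N + 1)"
      unfolding a_def b_def S_def by (simp add: add_divide_distrib[symmetric] algebra_simps diff_divide_distrib)
    ultimately have "2 * (real q + 1) * (S - 1) / (N + 1) \<le> 0" by simp
    then have "S \<le> 1" using N1 by (simp add: divide_le_0_iff mult_le_0_iff)
    then have "s * real q ^ e \<le> 1" by (simp add: S_def)
    moreover have "s * 1 \<le> s * real q ^ e" using qe s1 by (intro mult_left_mono) auto
    ultimately have "s = 1" using s1 by linarith
    then show False using False by simp
  next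
    case True
    then obtain c where c: "s = of_int c" using sqrt_int by (auto simp: s_def elim: Ints_cases)
    define r where "r = nat c"
    have r: "s = real r" "1 \<le> r" using c s1 by (auto simp: r_def)
    have qr: "q = r\<^sup>2" using ss unfolding r(1) by (metis of_nat_eq_iff of_nat_mult power2_eq_square)
    define R where "R = int r ^ (2 * e + 1)"
    have SR: "S = of_int R" unfolding S_def R_def r(1) qr by (simp add: power_mult)
    have "y \<in> \<rat>" unfolding yeq using SR by (simp add: N_def)
    then obtain z where z: "y = of_int z" using int by (auto elim: Ints_cases)
    have "of_int ((int q + 1 - z) * (R\<^sup>2 + 1)) = (of_int (2 * ((int r)\<^sup>2 + 1) * (R + 1)) :: real)"
      using eq unfolding SN[symmetric] SR z qr by simp
    then have zeq: "(int q + 1 - z) * (R\<^sup>2 + 1) = 2 * ((int r)\<^sup>2 + 1) * (R + 1)" by (simp only: of_int_eq_iff)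
    have pos: "0 < int q + 1 - z" using y(1) unfolding z by linarith
    show False
    \<comment> \<open>For \<open>q = 1\<close> the equation does have the solution
      \<open>y = -2\<close>, but that is minus the degree itself.\<close>
    proof (cases "r = 1")
      case True
      then have "z = - 2" "q = 1" using zeq qr by (auto simp: R_def)
      then show False using y(2) z by simp
    next
      case False
      then show False using int_times_power_Suc_neq_odd[OF pos _ e, of r] zeq r(2) by (simp add: R_def)
    qed
  qed
qed

section \<open>Neighbours and distances in Moore graphs\<close>

text \<open>A distance in the natural numbers, where \<open>graph_dist\<close> is real, allows
  induction on it. It carries meaning only if \<open>v\<close> is reachable from
  \<open>u\<close>.\<close>

definition gdist :: "('a, 'b) pre_digraph \<Rightarrow> 'a \<Rightarrow> 'a \<Rightarrow> nat" where
  "gdist G u v = (LEAST n. \<exists>p. pre_digraph.awalk G u p v \<and> length p = n)"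

lemma (in wf_digraph) gdist_le: "awalk u p v \<Longrightarrow> gdist G u v \<le> length p"
  unfolding gdist_def by (rule Least_le) blast

lemma (in wf_digraph) gdist_awalk:
  assumes "u \<rightarrow>\<^sup>* v"
  obtains p where "awalk u p v" "length p = gdist G u v"
proof -
  have "\<exists>n p. awalk u p v \<and> length p = n" using assms by (auto simp: reachable_awalk)
  then have "\<exists>p. awalk u p v \<and> length p = gdist G u v"
    unfolding gdist_def by (rule LeastI_ex)
  with that show thesis by blast
qed

lemma (in wf_digraph) graph_dist_eq_gdist:
  assumes "u \<rightarrow>\<^sup>* v"
  shows "graph_dist G u v = real (gdist G u v)"
proof -
  have len: "awalk_cost (\<lambda>_. 1) p = real (length p)" for p by (induction p) auto
  obtain p where p: "awalk u p v" "length p = gdist G u v" using gdist_awalk[OF assms] .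
  have "\<mu> (\<lambda>_. 1) u v = ereal (real (gdist G u v))"
    unfolding \<mu>_def
  proof (rule antisym)
    show "(INF p\<in>{p. awalk u p v}. ereal (awalk_cost (\<lambda>_. 1) p)) \<le> ereal (real (gdist G u v))"
      by (rule INF_lower2[of p]) (use p in \<open>auto simp: len\<close>)
  qed (auto intro!: INF_greatest simp: len gdist_le)
  then show ?thesis by (simp add: graph_dist_def)
qed

lemma (in wf_digraph) gdist_dominates_le:
  assumes "u \<rightarrow> w" "w \<rightarrow>\<^sup>* v"
  shows "gdist G u v \<le> Suc (gdist G w v)"
proof -
  obtain p where p: "awalk w p v" "length p = gdist G w v" using gdist_awalk[OF assms(2)] .
  obtain e where "e \<in> arcs G" "tail G e = u" "head G e = w" using assms(1) by auto
  then have "awalk u (e # p) v" using p by (auto simp: awalk_Cons_iff)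
  from gdist_le[OF this] p show ?thesis by simp
qed

lemma (in wf_digraph) gdist_Suc:
  assumes "u \<rightarrow>\<^sup>* v" "gdist G u v = Suc i"
  obtains w where "u \<rightarrow> w" "gdist G w v = i"
proof -
  obtain p where p: "awalk u p v" "length p = Suc i" using gdist_awalk[OF assms(1)] assms(2) by metis
  then obtain e p' where e: "p = e # p'" by (cases p) auto
  then have w: "awalk (head G e) p' v" "u \<rightarrow> head G e" using p
    by (auto simp: awalk_Cons_iff dest: in_arcs_imp_in_arcs_ends)
  then have "gdist G (head G e) v \<le> i" using gdist_le[OF w(1)] p e by simp
  moreover have "Suc i \<le> Suc (gdist G (head G e) v)"
    using gdist_dominates_le[OF w(2) reachable_awalkI[OF w(1)]] assms(2) by simp
  ultimately show thesis using that[OF w(2)] by simp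
qed

lemma (in wf_digraph) gdist_eq_0_iff:
  assumes "u \<rightarrow>\<^sup>* v"
  shows "gdist G u v = 0 \<longleftrightarrow> u = v"
proof
  assume "gdist G u v = 0"
  then show "u = v" using gdist_awalk[OF assms] by (metis awalk_Nil_iff length_0_conv)
next
  assume "u = v"
  then have "awalk u [] v" using assms reachable_in_verts(1) by (auto simp: awalk_Nil_iff)
  from gdist_le[OF this] show "gdist G u v = 0" by simp
qed

text \<open>Closed walks below are assembled from geodesics by index, as functions from positions to
  vertices; this turns them into arc lists.\<close>

lemma (in wf_digraph) awalk_of_fun:
  assumes "\<And>i. i < m \<Longrightarrow> x i \<rightarrow> x (Suc i)" "x 0 \<in> verts G"
  shows "\<exists>p. awalk (x 0) p (x m) \<and> awalk_verts (x 0) p = map x [0..<Suc m]"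
  using assms
proof (induction m arbitrary: x)
  case 0
  then show ?case by (intro exI[of _ "[]"]) (auto simp: awalk_Nil_iff)
next
  case (Suc m)
  have "x 0 \<rightarrow> x 1" using Suc.prems(1)[of 0] by simp
  then obtain e where e: "e \<in> arcs G" "tail G e = x 0" "head G e = x 1" by auto
  then have "x 1 \<in> verts G" by (metis head_in_verts)
  have "\<exists>p. awalk (x (Suc 0)) p (x (Suc m)) \<and> awalk_verts (x (Suc 0)) p = map (\<lambda>i. x (Suc i)) [0..<Suc m]"
    using Suc.IH[of "\<lambda>i. x (Suc i)"] Suc.prems(1) \<open>x 1 \<in> verts G\<close> by auto
  then obtain p where p: "awalk (x 1) p (x (Suc m))" "awalk_verts (x 1) p = map (\<lambda>i. x (Suc i)) [0..<Suc m]"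
    by auto
  have "map x [0..<Suc (Suc m)] = x 0 # map (\<lambda>i. x (Suc i)) [0..<Suc m]"
    by (simp add: upt_conv_Cons map_Suc_upt[symmetric] del: upt_Suc)
  then show ?case using p e by (intro exI[of _ "e # p"]) (auto simp: awalk_Cons_iff simp del: upt_Suc)
qed

text \<open>A shortest segment between two visits to the same vertex is a cycle: there are no loops,
  \<open>nb\<close> excludes length 2, and a repetition inside the segment would give a shorter
  one.\<close>

lemma (in loopfree_digraph) girth_le_closed_nonbacktracking:
  assumes walk: "\<And>i. i < m \<Longrightarrow> x i \<rightarrow> x (Suc i)"
    and nb: "\<And>i. i + 2 \<le> m \<Longrightarrow> x i \<noteq> x (i + 2)"
    and closed: "x m = x 0" "0 < m"
  shows "girth G \<le> enat m"
proof -
  define R where "R L \<longleftrightarrow> 0 < L \<and> (\<exists>a. a + L \<le> m \<and> x a = x (a + L))" for L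
  define L where "L = (LEAST L. R L)"
  have "R m" unfolding R_def using closed by (auto intro!: exI[of _ 0])
  then have RL: "R L" unfolding L_def by (rule LeastI)
  have least: "L \<le> L'" if "R L'" for L' unfolding L_def using that by (rule Least_le)
  obtain a where a: "0 < L" "a + L \<le> m" "x a = x (a + L)" using RL by (auto simp: R_def)
  have "L \<noteq> 1"
  proof
    assume "L = 1"
    then have "x a \<rightarrow> x a" using walk[of a] a by auto
    then obtain e where "e \<in> arcs G" "tail G e = x a" "head G e = x a" by auto
    then show False using no_loops by metis
  qed
  moreover have "L \<noteq> 2" using nb[of a] a by auto
  ultimately have L3: "3 \<le> L" using a by simp
  define y where "y i = x (a + i)" for i
  have "x a \<rightarrow> x (Suc a)" using walk[of a] a(1,2) by simp
  then have "y 0 \<in> verts G" unfolding y_def using adj_in_verts(1) by simp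
  then obtain p where p: "awalk (y 0) p (y L)" "awalk_verts (y 0) p = map y [0..<Suc L]"
    using awalk_of_fun[of L y] walk a by (auto simp: y_def)
  have len: "length p = L" using arg_cong[OF p(2), of length] by (simp add: length_awalk_verts)
  have "inj_on y {1..<Suc L}"
  proof (rule linorder_inj_onI)
    fix i j assume ij: "i < j" "i \<in> {1..<Suc L}" "j \<in> {1..<Suc L}"
    show "y i \<noteq> y j"
    proof
      assume "y i = y j"
      then have "R (j - i)" unfolding R_def y_def using ij a by (auto intro!: exI[of _ "a + i"])
      from least[OF this] ij show False by auto
    qed
  qed auto
  then have "distinct (tl (awalk_verts (y 0) p))"
    unfolding p(2) by (simp add: upt_conv_Cons distinct_map del: upt_Suc)
  moreover have "y L = y 0" using a by (simp add: y_def)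
  ultimately have "cycle p" unfolding cycle_def using p len a by auto
  then have "girth G \<le> enat (length p)" unfolding girth_def using L3 len by (intro INF_lower) auto
  also have "\<dots> \<le> enat m" using len a by simp
  finally show ?thesis .
qed

section \<open>Regular graphs of given girth: neighbours, geodesics and short closed walks\<close>

locale connected_kg_graph = graph G for G :: "('a, 'b) pre_digraph" (structure) +
  fixes k g :: nat
  assumes conn: "Digraph_Component.connected G" and reg: "regular k G" and girth: "girth G = enat g"
begin

abbreviation "f \<equiv> gdist G"
definition "nbrs u = {w. u \<rightarrow> w}"

lemma reach: "u \<in> verts G \<Longrightarrow> v \<in> verts G \<Longrightarrow> u \<rightarrow>\<^sup>* v"
  using symmetric_connected_imp_strongly_connected[OF sym_arcs conn] by auto

lemma nbrs_verts: "nbrs u \<subseteq> verts G" by (auto simp: nbrs_def)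

lemma finite_nbrs [simp]: "finite (nbrs u)"
  using finite_subset[OF nbrs_verts] by simp

lemma nbrs_sym: "w \<in> nbrs u \<longleftrightarrow> u \<in> nbrs w"
  using sym_arcs by (auto simp: nbrs_def symmetric_def dest: symD)

lemma not_in_nbrs: "u \<notin> nbrs u"
proof
  assume "u \<in> nbrs u"
  then obtain e where "e \<in> arcs G" "tail G e = u" "head G e = u" by (auto simp: nbrs_def)
  then show False using no_loops by metis
qed

lemma card_nbrs: assumes "u \<in> verts G" shows "card (nbrs u) = k"
proof -
  have "bij_betw (head G) (out_arcs G u) (nbrs u)"
  proof (rule bij_betwI')
    fix e1 e2 assume "e1 \<in> out_arcs G u" "e2 \<in> out_arcs G u"
    then show "(head G e1 = head G e2) = (e1 = e2)"
      using no_multi_arcs[of e1 e2] by (auto simp: arc_to_ends_def)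
  next
    fix w assume "w \<in> nbrs u"
    then obtain e where "e \<in> arcs G" "tail G e = u" "head G e = w" by (auto simp: nbrs_def)
    then show "\<exists>e\<in>out_arcs G u. w = head G e" by (auto intro!: bexI[of _ e])
  qed (auto simp: nbrs_def intro: in_arcs_imp_in_arcs_ends)
  then have "card (out_arcs G u) = card (nbrs u)" by (rule bij_betw_same_card)
  with reg assms show ?thesis by (auto simp: regular_def out_degree_def)
qed

text \<open>Finite girth provides a cycle of length at least 3; its second vertex \<open>a\<close>
  then has the two distinct neighbours \<open>u\<close> and \<open>b\<close>.\<close>

lemma g_ge_3: "3 \<le> g" and k_ge_2: "2 \<le> k"
proof -
  let ?C = "{p. cycle p \<and> 3 \<le> length p}"
  have "enat 3 \<le> girth G" unfolding girth_def by (rule INF_greatest) auto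
  then show "3 \<le> g" using girth by simp
  have "?C \<noteq> {}"
  proof
    assume "?C = {}"
    then have "girth G = \<infinity>" unfolding girth_def \<open>?C = {}\<close> by (simp add: top_enat_def)
    with girth show False by simp
  qed
  then obtain p u where p: "awalk u p u" "distinct (tl (awalk_verts u p))" "3 \<le> length p"
    by (auto simp: cycle_def)
  obtain e1 p1 where p1: "p = e1 # p1" using p(3) by (cases p) auto
  obtain e2 p2 where p2: "p1 = e2 # p2" using p(3) p1 by (cases p1) auto
  obtain e3 p3 where p3: "p2 = e3 # p3" using p(3) p1 p2 by (cases p2) auto
  define a b where "a = head G e1" and "b = head G e2"
  have "u \<rightarrow> a" "a \<rightarrow> b"
    using p(1) unfolding p1 p2 a_def b_def
    by (auto simp: awalk_Cons_iff dest: in_arcs_imp_in_arcs_ends)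
  then have sub: "{u, b} \<subseteq> nbrs a" using nbrs_sym[of u a] by (auto simp: nbrs_def)
  have wk: "awalk (head G e3) p3 u" "tail G e3 = b" using p(1) unfolding p1 p2 p3 b_def by (auto simp: awalk_Cons_iff)
  then have "u \<in> set (awalk_verts (head G e3) p3)"
    using awalkE[OF wk(1)] by (metis last_in_set awalk_verts_non_Nil)
  moreover have "b \<notin> set (awalk_verts (head G e3) p3)"
    using p(2) wk(2) unfolding p1 p2 p3 by simp
  ultimately have "u \<noteq> b" by auto
  then have "2 \<le> card (nbrs a)" using card_mono[OF finite_nbrs sub] by simp
  moreover have "a \<in> verts G" using \<open>u \<rightarrow> a\<close> by auto
  ultimately show "2 \<le> k" using card_nbrs by simp
qed

lemma gdist_nbrs:
  assumes "u \<in> verts G" "v \<in> verts G" "w \<in> nbrs u"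
  shows "f u v \<le> Suc (f w v)" "f w v \<le> Suc (f u v)"
proof -
  have "u \<rightarrow> w" "w \<rightarrow> u" "w \<in> verts G" using assms(3) nbrs_sym[of w u] by (auto simp: nbrs_def)
  then show "f u v \<le> Suc (f w v)" "f w v \<le> Suc (f u v)"
    using gdist_dominates_le reach assms by auto
qed

lemma geodesic:
  assumes "u \<in> verts G" "v \<in> verts G"
  obtains x where "x 0 = u" "\<And>i. i \<le> f u v \<Longrightarrow> f (x i) v = f u v - i"
    "\<And>i. i < f u v \<Longrightarrow> x i \<rightarrow> x (Suc i)" "x (f u v) = v"
proof -
  have "\<exists>x. x 0 = u \<and> (\<forall>i\<le>n. f (x i) v = n - i) \<and> (\<forall>i<n. x i \<rightarrow> x (Suc i)) \<and> x n = v"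
    if "f u v = n" for n
    using that assms
  proof (induction n arbitrary: u)
    case 0
    then show ?case using gdist_eq_0_iff[OF reach] by (intro exI[of _ "\<lambda>_. u"]) auto
  next
    case (Suc n)
    obtain w where w: "u \<rightarrow> w" "f w v = n" using gdist_Suc[OF reach Suc.prems(1)] Suc.prems by metis
    have "w \<in> verts G" using w(1) by auto
    then obtain x where x: "x 0 = w" "\<forall>i\<le>n. f (x i) v = n - i" "\<forall>i<n. x i \<rightarrow> x (Suc i)" "x n = v"
      using Suc.IH[of w] w(2) Suc.prems(3) by blast
    define y where "y i = (case i of 0 \<Rightarrow> u | Suc j \<Rightarrow> x j)" for i
    show ?case
      by (intro exI[of _ y]) (use x w Suc.prems in \<open>auto simp: y_def split: nat.splits\<close>)
  qed
  from this[OF refl] that show thesis by blast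
qed

text \<open>Otherwise the walk from \<open>v\<close> along a geodesic to \<open>y\<close>, through
  \<open>x\<close> to \<open>z\<close> and back to \<open>v\<close> is closed of length
  \<open>2 * Suc i\<close>. Positions two apart differ in their distance to \<open>v\<close>, except
  around \<open>x\<close>, where \<open>y \<noteq> z\<close>.\<close>

lemma unique_closer_nbr:
  assumes v: "v \<in> verts G" and y: "y \<in> nbrs x" "f y v = i" and z: "z \<in> nbrs x" "f z v = i"
    and fx: "f x v = Suc i" and small: "2 * Suc i < g"
  shows "y = z"
proof (rule ccontr)
  assume "y \<noteq> z"
  have yz: "y \<in> verts G" "z \<in> verts G" using y z nbrs_verts by auto
  have e: "y \<rightarrow> x" "x \<rightarrow> z" using y z nbrs_sym[of y x] by (auto simp: nbrs_def)
  obtain Y where Y: "Y 0 = y" "\<And>j. j \<le> i \<Longrightarrow> f (Y j) v = i - j" "\<And>j. j < i \<Longrightarrow> Y j \<rightarrow> Y (Suc j)" "Y i = v"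
    using geodesic[OF yz(1) v] y(2) by metis
  obtain Z where Z: "Z 0 = z" "\<And>j. j \<le> i \<Longrightarrow> f (Z j) v = i - j" "\<And>j. j < i \<Longrightarrow> Z j \<rightarrow> Z (Suc j)" "Z i = v"
    using geodesic[OF yz(2) v] z(2) by metis
  define W where "W t = (if t \<le> i then Y (i - t) else if t = Suc i then x else Z (t - i - 2))" for t
  have fW: "f (W t) v = (if t \<le> Suc i then t else 2 * Suc i - t)" if "t \<le> 2 * Suc i" for t
    using that Y(2)[of "i - t"] Z(2)[of "t - i - 2"] fx by (auto simp: W_def)
  have "girth G \<le> enat (2 * Suc i)"
  proof (rule girth_le_closed_nonbacktracking[of _ W])
    fix t assume t: "t < 2 * Suc i"
    consider "t < i" | "t = i" | "t = Suc i" | "Suc i < t" by linarith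
    then show "W t \<rightarrow> W (Suc t)"
    proof cases
      case 1
      then have "Y (i - Suc t) \<rightarrow> Y (Suc (i - Suc t))" using Y(3) by simp
      moreover have "Suc (i - Suc t) = i - t" using 1 by simp
      ultimately have "Y (i - t) \<rightarrow> Y (i - Suc t)" using nbrs_sym by (metis nbrs_def mem_Collect_eq)
      then show ?thesis using 1 by (simp add: W_def)
    next
      case 4
      then have "Z (t - i - 2) \<rightarrow> Z (Suc (t - i - 2))" using Z(3) t by simp
      moreover have "Suc (t - i - 2) = Suc t - i - 2" using 4 by simp
      ultimately show ?thesis using 4 by (simp add: W_def)
    qed (use e Y Z in \<open>auto simp: W_def\<close>)
  next
    fix t assume t: "t + 2 \<le> 2 * Suc i"
    show "W t \<noteq> W (t + 2)"
    proof (cases "t = i")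
      case True
      then show ?thesis using \<open>y \<noteq> z\<close> Y Z by (simp add: W_def)
    next
      case False
      have "f (W t) v \<noteq> f (W (t + 2)) v"
        using fW[of t] fW[of "t + 2"] t False by (auto split: if_splits)
      then show ?thesis by auto
    qed
  qed (use Y Z in \<open>auto simp: W_def\<close>)
  with small girth show False by simp
qed

text \<open>Such an edge joins two geodesics to a closed walk of odd length
  \<open>2 * i + 1\<close>, and by parity positions two apart never have the same distance to
  \<open>v\<close>.\<close>

lemma no_level_edge:
  assumes v: "v \<in> verts G" and y: "y \<in> nbrs x" "f y v = i" and fx: "f x v = i" and small: "2 * i + 1 < g"
  shows False
proof -
  have e: "x \<rightarrow> y" "x \<in> verts G" "y \<in> verts G" using y by (auto simp: nbrs_def)
  obtain X where X: "X 0 = x" "\<And>j. j \<le> i \<Longrightarrow> f (X j) v = i - j" "\<And>j. j < i \<Longrightarrow> X j \<rightarrow> X (Suc j)" "X i = v"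
    using geodesic[OF e(2) v] fx by metis
  obtain Y where Y: "Y 0 = y" "\<And>j. j \<le> i \<Longrightarrow> f (Y j) v = i - j" "\<And>j. j < i \<Longrightarrow> Y j \<rightarrow> Y (Suc j)" "Y i = v"
    using geodesic[OF e(3) v] y(2) by metis
  define W where "W t = (if t \<le> i then X (i - t) else Y (t - i - 1))" for t
  have fW: "f (W t) v = (if t \<le> i then t else 2 * i + 1 - t)" if "t \<le> 2 * i + 1" for t
    using that X(2)[of "i - t"] Y(2)[of "t - i - 1"] by (auto simp: W_def)
  have "girth G \<le> enat (2 * i + 1)"
  proof (rule girth_le_closed_nonbacktracking[of _ W])
    fix t assume t: "t < 2 * i + 1"
    consider "t < i" | "t = i" | "i < t" by linarith
    then show "W t \<rightarrow> W (Suc t)"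
    proof cases
      case 1
      then have "X (i - Suc t) \<rightarrow> X (Suc (i - Suc t))" using X(3) by simp
      moreover have "Suc (i - Suc t) = i - t" using 1 by simp
      ultimately have "X (i - t) \<rightarrow> X (i - Suc t)" using nbrs_sym by (metis nbrs_def mem_Collect_eq)
      then show ?thesis using 1 by (simp add: W_def)
    next
      case 3
      then have "Y (t - i - 1) \<rightarrow> Y (Suc (t - i - 1))" using Y(3) t by simp
      moreover have "Suc (t - i - 1) = Suc t - i - 1" using 3 by simp
      ultimately show ?thesis using 3 by (simp add: W_def)
    qed (use e X Y in \<open>auto simp: W_def\<close>)
  next
    fix t assume t: "t + 2 \<le> 2 * i + 1"
    have "f (W t) v \<noteq> f (W (t + 2)) v"
      using fW[of t] fW[of "t + 2"] t by (simp split: if_splits) presburger+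
    then show "W t \<noteq> W (t + 2)" by auto
  qed (use X Y in \<open>auto simp: W_def\<close>)
  with small girth show False by simp
qed

lemma closer_nbr_singleton:
  assumes uv: "u \<in> verts G" "v \<in> verts G" and fu: "f u v = Suc i" and small: "2 * Suc i < g"
  obtains y where "y \<in> nbrs u" "f y v = i" "{w \<in> nbrs u. f w v = i} = {y}"
proof -
  obtain y where y: "u \<rightarrow> y" "f y v = i" using gdist_Suc[OF reach[OF uv] fu] .
  then have "{w \<in> nbrs u. f w v = i} = {y}"
    using unique_closer_nbr[OF uv(2) _ _ _ _ fu small] by (auto simp: nbrs_def)
  then show thesis using that[of y] y by (auto simp: nbrs_def)
qed

text \<open>One neighbour is closer and none is at the same distance, so the rest are farther. The
  arbitrary weight \<open>\<eta>\<close> lets one computation serve every matrix whose entries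
  depend only on the distance.\<close>

lemma sum_nbrs_interior:
  fixes \<eta> :: "nat \<Rightarrow> real"
  assumes uv: "u \<in> verts G" "v \<in> verts G" and fu: "f u v = Suc i" and small: "2 * Suc i + 1 < g"
  shows "(\<Sum>w\<in>nbrs u. \<eta> (f w v)) = \<eta> i + (real k - 1) * \<eta> (i + 2)"
    and "card {w \<in> nbrs u. f w v = i + 2} = k - 1"
proof -
  obtain y where y: "y \<in> nbrs u" "f y v = i" "{w \<in> nbrs u. f w v = i} = {y}"
    using closer_nbr_singleton[OF uv fu] small by auto
  have far: "f w v = i + 2" if "w \<in> nbrs u - {y}" for w
  proof -
    have "f w v \<noteq> i" using that y by auto
    moreover have "f w v \<noteq> Suc i" using no_level_edge[OF uv(2) _ _ fu small] that by auto
    ultimately show ?thesis using gdist_nbrs[OF uv, of w] that fu by auto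
  qed
  have k: "card (nbrs u - {y}) = k - 1" using y(1) card_nbrs[OF uv(1)] by simp
  have "(\<Sum>w\<in>nbrs u. \<eta> (f w v)) = \<eta> (f y v) + (\<Sum>w\<in>nbrs u - {y}. \<eta> (f w v))"
    using y(1) by (intro sum.remove) auto
  also have "(\<Sum>w\<in>nbrs u - {y}. \<eta> (f w v)) = (\<Sum>w\<in>nbrs u - {y}. \<eta> (i + 2))"
    using far by (intro sum.cong) auto
  finally show "(\<Sum>w\<in>nbrs u. \<eta> (f w v)) = \<eta> i + (real k - 1) * \<eta> (i + 2)"
    using k y k_ge_2 by (simp add: of_nat_diff)
  have "{w \<in> nbrs u. f w v = i + 2} = nbrs u - {y}" using far y by auto
  with k show "card {w \<in> nbrs u. f w v = i + 2} = k - 1" by simp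
qed

lemma sum_nbrs_root:
  fixes \<eta> :: "nat \<Rightarrow> real"
  assumes v: "v \<in> verts G"
  shows "(\<Sum>w\<in>nbrs v. \<eta> (f w v)) = k * \<eta> 1"
proof -
  have "f w v = 1" if "w \<in> nbrs v" for w
  proof -
    have "w \<in> verts G" "w \<noteq> v" using that nbrs_verts not_in_nbrs by auto
    then have "f w v \<noteq> 0" using gdist_eq_0_iff[OF reach] v by auto
    moreover have "f v v = 0" using gdist_eq_0_iff[OF reach] v by auto
    ultimately show ?thesis using gdist_nbrs[OF v v that] by simp
  qed
  then have "(\<Sum>w\<in>nbrs v. \<eta> (f w v)) = (\<Sum>w\<in>nbrs v. \<eta> 1)" by (intro sum.cong) auto
  then show ?thesis using card_nbrs[OF v] by simp
qed

section \<open>Sizes of the distance levels and the effect of attaining the Moore bound\<close>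

definition "level v i = {u \<in> verts G. f u v = i}"

lemma finite_level [simp]: "finite (level v i)" by (auto simp: level_def)

lemma level_0: "v \<in> verts G \<Longrightarrow> level v 0 = {v}"
  using gdist_eq_0_iff[OF reach] by (auto simp: level_def)

lemma double_count:
  assumes "finite R" "finite S"
  shows "(\<Sum>x\<in>S. card {w \<in> nbrs x. w \<in> R}) = (\<Sum>r\<in>R. card {w \<in> nbrs r. w \<in> S})"
proof -
  have "(\<Sum>x\<in>S. card {w \<in> nbrs x. w \<in> R}) = (\<Sum>x\<in>S. \<Sum>r\<in>R. if r \<in> nbrs x then 1 else 0)"
    using assms by (intro sum.cong refl)
      (auto simp: sum.If_cases Int_def conj_commute intro!: arg_cong[of _ _ card])
  also have "\<dots> = (\<Sum>r\<in>R. \<Sum>x\<in>S. if x \<in> nbrs r then 1 else 0)"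
    by (subst sum.swap) (simp add: nbrs_sym)
  also have "\<dots> = (\<Sum>r\<in>R. card {w \<in> nbrs r. w \<in> S})"
    using assms by (intro sum.cong refl)
      (auto simp: sum.If_cases Int_def conj_commute intro!: arg_cong[of _ _ card])
  finally show ?thesis .
qed

lemma card_nbrs_level:
  assumes v: "v \<in> verts G" and x: "x \<in> level v i" and small: "2 * i + 1 < g"
  shows "card {w \<in> nbrs x. w \<in> level v (Suc i)} = (if i = 0 then k else k - 1)"
proof -
  have xv: "x \<in> verts G" "f x v = i" using x by (auto simp: level_def)
  have eq: "{w \<in> nbrs x. w \<in> level v (Suc i)} = {w \<in> nbrs x. f w v = Suc i}"
    using nbrs_verts by (auto simp: level_def)
  show ?thesis
  proof (cases i)
    case 0
    then have "x = v" using level_0[OF v] x by simp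
    then have "real (card {w \<in> nbrs x. f w v = Suc i}) = k"
      using sum_nbrs_root[OF v, of "\<lambda>j. if j = 1 then 1 else 0"] 0
      by (simp add: sum.If_cases Int_def)
    then show ?thesis unfolding eq using 0 by simp
  next
    case (Suc j)
    then show ?thesis unfolding eq using sum_nbrs_interior(2)[of x v j] xv v small by simp
  qed
qed

text \<open>Count edges between consecutive levels: each outer vertex has one neighbour inside, each
  inner vertex \<open>k - 1\<close> outside, or \<open>k\<close> if it is the root.\<close>

lemma card_level:
  assumes v: "v \<in> verts G"
  shows "2 * Suc i < g \<Longrightarrow> card (level v (Suc i)) = k * (k - 1) ^ i"
proof (induction i)
  case (Suc i)
  have one: "card {w \<in> nbrs r. w \<in> level v j} = 1" if r: "r \<in> level v (Suc j)" and j: "2 * Suc j < g" for r j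
  proof -
    have r: "r \<in> verts G" "f r v = Suc j" using r by (auto simp: level_def)
    obtain y where "{w \<in> nbrs r. f w v = j} = {y}"
      using closer_nbr_singleton[OF r(1) v r(2) j] by auto
    moreover have "{w \<in> nbrs r. w \<in> level v j} = {w \<in> nbrs r. f w v = j}"
      using nbrs_verts by (auto simp: level_def)
    ultimately show ?thesis by simp
  qed
  have "card (level v (Suc (Suc i))) = (\<Sum>r\<in>level v (Suc (Suc i)). card {w \<in> nbrs r. w \<in> level v (Suc i)})"
    using one Suc.prems by simp
  also have "\<dots> = (\<Sum>x\<in>level v (Suc i). card {w \<in> nbrs x. w \<in> level v (Suc (Suc i))})"
    by (rule double_count[symmetric]) auto
  also have "\<dots> = (\<Sum>x\<in>level v (Suc i). k - 1)"
    by (intro sum.cong refl, subst card_nbrs_level[OF v]) (use Suc.prems in auto)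
  finally show ?case using Suc by simp
next
  case 0
  have "card (level v 1) = (\<Sum>r\<in>level v 1. card {w \<in> nbrs r. w \<in> level v 0})"
  proof -
    have "card {w \<in> nbrs r. w \<in> level v 0} = 1" if r: "r \<in> level v 1" for r
    proof -
      have r: "r \<in> verts G" "f r v = Suc 0" using r by (auto simp: level_def)
      obtain y where "{w \<in> nbrs r. f w v = 0} = {y}"
        using closer_nbr_singleton[OF r(1) v r(2) 0] by auto
      moreover have "{w \<in> nbrs r. w \<in> level v 0} = {w \<in> nbrs r. f w v = 0}"
        using nbrs_verts by (auto simp: level_def)
      ultimately show ?thesis by simp
    qed
    then show ?thesis by simp
  qed
  also have "\<dots> = (\<Sum>x\<in>level v 0. card {w \<in> nbrs x. w \<in> level v 1})"
    by (rule double_count[symmetric]) auto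
  also have "\<dots> = k"
    using level_0[OF v] card_nbrs_level[OF v, of v 0] 0 by simp
  finally show ?case by simp
qed

lemma card_ball:
  assumes v: "v \<in> verts G" and "2 * m < g"
  shows "card {u \<in> verts G. f u v \<le> m} = 1 + (\<Sum>i<m. k * (k - 1) ^ i)"
  using assms(2)
proof (induction m)
  case 0
  then show ?case using level_0[OF v] by (simp add: level_def)
next
  case (Suc m)
  have "{u \<in> verts G. f u v \<le> Suc m} = {u \<in> verts G. f u v \<le> m} \<union> level v (Suc m)"
    by (auto simp: level_def)
  moreover have "{u \<in> verts G. f u v \<le> m} \<inter> level v (Suc m) = {}" by (auto simp: level_def)
  ultimately show ?case
    using Suc card_level[OF v, of m] by (subst \<open>_ = _ \<union> _\<close>, subst card_Un_disjoint) auto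
qed

text \<open>The ball of radius \<open>d\<close> alone attains the Moore bound, so nothing lies
  beyond it, and at distance \<open>d\<close> all neighbours but the single closer one stay at
  distance \<open>d\<close>.\<close>

lemma moore_sum_nbrs_odd:
  fixes \<eta> :: "nat \<Rightarrow> real"
  assumes g: "g = 2 * d + 1" and card: "card (verts G) = moore_bound k g"
    and uv: "u \<in> verts G" "v \<in> verts G"
  shows "f u v \<le> d"
    and "f u v = d \<Longrightarrow> (\<Sum>w\<in>nbrs u. \<eta> (f w v)) = \<eta> (d - 1) + (real k - 1) * \<eta> d"
proof -
  have "card {u \<in> verts G. f u v \<le> d} = card (verts G)"
    using card_ball[OF uv(2), of d] g card by (simp add: moore_bound_def)
  then have "{u \<in> verts G. f u v \<le> d} = verts G" by (intro card_subset_eq) auto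
  then have all: "f u v \<le> d" if "u \<in> verts G" for u using that by auto
  show "f u v \<le> d" using all uv by simp
  assume fu: "f u v = d"
  obtain i where i: "d = Suc i" using g_ge_3 g by (cases d) auto
  obtain y where y: "y \<in> nbrs u" "f y v = i" "{w \<in> nbrs u. f w v = i} = {y}"
    using closer_nbr_singleton[OF uv] fu i g by auto
  have far: "f w v = d" if "w \<in> nbrs u - {y}" for w
  proof -
    have "f w v \<noteq> i" "w \<in> verts G" using that y nbrs_verts by auto
    then show ?thesis using gdist_nbrs[OF uv, of w] that fu i all[of w] by auto
  qed
  have "(\<Sum>w\<in>nbrs u. \<eta> (f w v)) = \<eta> (f y v) + (\<Sum>w\<in>nbrs u - {y}. \<eta> (f w v))"
    using y(1) by (intro sum.remove) auto
  also have "(\<Sum>w\<in>nbrs u - {y}. \<eta> (f w v)) = (\<Sum>w\<in>nbrs u - {y}. \<eta> d)"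
    using far by (intro sum.cong) auto
  finally show "(\<Sum>w\<in>nbrs u. \<eta> (f w v)) = \<eta> (d - 1) + (real k - 1) * \<eta> d"
    using card_nbrs[OF uv(1)] y k_ge_2 i by (simp add: of_nat_diff)
qed

text \<open>
  There are \<open>k (k - 1)\<^bsup>d-1\<^esup>\<close> edges leaving the ball of radius \<open>d - 1\<close>, and the Moore bound leaves
  only \<open>(k - 1)\<^bsup>d-1\<^esup>\<close> vertices outside it, so these spend all their edges on the ball.
\<close>

lemma moore_sum_nbrs_even:
  fixes \<eta> :: "nat \<Rightarrow> real"
  assumes g: "g = 2 * d" and card: "card (verts G) = moore_bound k g"
    and uv: "u \<in> verts G" "v \<in> verts G"
  shows "f u v \<le> d"
    and "f u v = d \<Longrightarrow> (\<Sum>w\<in>nbrs u. \<eta> (f w v)) = k * \<eta> (d - 1)"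
proof -
  obtain i where i: "d = Suc (Suc i)" using g_ge_3 g by (cases d; cases "d - 1") auto
  define B R where "B = {u \<in> verts G. f u v \<le> Suc i}" and "R = verts G - B"
  have fin: "finite B" "finite R" by (auto simp: B_def R_def)
  have "card B = 1 + (\<Sum>i<Suc i. k * (k - 1) ^ i)"
    unfolding B_def using card_ball[OF uv(2), of "Suc i"] g i by simp
  moreover have "card (verts G) = card B + card R"
    unfolding R_def by (subst card_Diff_subset) (auto simp: B_def card_mono)
  ultimately have cR: "card R = (k - 1) ^ Suc i" using card g i by (simp add: moore_bound_def)
  have out: "card {w \<in> nbrs x. w \<in> R} = k - 1" if x: "x \<in> level v (Suc i)" for x
  proof -
    have xv: "x \<in> verts G" "f x v = Suc i" using x by (auto simp: level_def)
    have "{w \<in> nbrs x. w \<in> R} = {w \<in> nbrs x. w \<in> level v (Suc (Suc i))}"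
      using gdist_nbrs[OF xv(1) uv(2)] xv(2) by (fastforce simp: R_def B_def level_def)
    then show ?thesis using card_nbrs_level[OF uv(2) x] g i by simp
  qed
  have le: "card {w \<in> nbrs r. w \<in> level v (Suc i)} \<le> k" if "r \<in> R" for r
    using card_mono[of "nbrs r" "{w \<in> nbrs r. w \<in> level v (Suc i)}"] card_nbrs[of r] that
    by (auto simp: R_def)
  have "(\<Sum>r\<in>R. card {w \<in> nbrs r. w \<in> level v (Suc i)}) = (\<Sum>x\<in>level v (Suc i). card {w \<in> nbrs x. w \<in> R})"
    using fin by (intro double_count[symmetric]) auto
  also have "\<dots> = (\<Sum>r\<in>R. k)"
    using out card_level[OF uv(2), of i] g i cR by simp
  finally have sum_eq: "(\<Sum>r\<in>R. card {w \<in> nbrs r. w \<in> level v (Suc i)}) = (\<Sum>r\<in>R. k)" .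
  have full: "f w v = Suc i" if r: "r \<in> R" and w: "w \<in> nbrs r" for r w
  proof -
    \<comment> \<open>Every summand is at most \<open>k\<close> and the total is the largest
      possible, so each vertex of \<open>R\<close> has all its neighbours in
      \<open>level v (Suc i)\<close>.\<close>
    have "card {w \<in> nbrs r. w \<in> level v (Suc i)} = card (nbrs r)"
      using sum_mono_inv[OF sum_eq le r] fin r card_nbrs[of r] by (auto simp: R_def)
    then have "{w \<in> nbrs r. w \<in> level v (Suc i)} = nbrs r" by (intro card_subset_eq) auto
    then show ?thesis using w by (auto simp: level_def)
  qed
  have fR: "f r v = d" if r: "r \<in> R" for r
  proof -
    have rv: "r \<in> verts G" using r by (simp add: R_def)
    have "nbrs r \<noteq> {}" using card_nbrs[OF rv] k_ge_2 by auto
    then obtain w where "w \<in> nbrs r" by auto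
    from gdist_nbrs[OF rv uv(2) this] full[OF r this] r rv show ?thesis
      by (auto simp: R_def B_def i)
  qed
  show "f u v \<le> d"
    using fR[of u] uv(1) i by (cases "u \<in> R") (auto simp: R_def B_def)
  assume "f u v = d"
  then have "u \<in> R" using uv(1) i by (auto simp: R_def B_def)
  from full[OF this] have "(\<Sum>w\<in>nbrs u. \<eta> (f w v)) = (\<Sum>w\<in>nbrs u. \<eta> (d - 1))"
    using i by (intro sum.cong) auto
  then show "(\<Sum>w\<in>nbrs u. \<eta> (f w v)) = k * \<eta> (d - 1)" using card_nbrs[OF uv(1)] by simp
qed

end

section \<open>The distance matrix as a polynomial in the adjacency matrix\<close>

locale moore_graph = connected_kg_graph G k g for G :: "('a, 'b) pre_digraph" (structure) and k g +
  fixes vs :: "'a list" and d :: nat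
  assumes vs: "distinct vs" "set vs = verts G"
    and card_moore: "card (verts G) = moore_bound k g"
    and d: "d = g div 2"
begin

text \<open>The tridiagonal action of the adjacency matrix on weights of the distance. Distances do
  not exceed \<open>d\<close>, so the last two cases concern \<open>t = d\<close> only.\<close>

definition "nbr_sum \<eta> t = (if t = 0 then real k * \<eta> 1
    else if t < d then \<eta> (t - 1) + (real k - 1) * \<eta> (t + 1)
    else if even g then real k * \<eta> (d - 1)
    else \<eta> (d - 1) + (real k - 1) * \<eta> d)"

text \<open>Matrices constant on distance classes. Multiplication by \<open>A\<close> preserves this
  shape, so identities between polynomials in \<open>A\<close> become identities between weights on
  distances up to \<open>d\<close>.\<close>

definition "dmat (\<eta> :: nat \<Rightarrow> real) = mat (length vs) (length vs) (\<lambda>(i, j). \<eta> (f (vs ! i) (vs ! j)))"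

abbreviation "A \<equiv> adjacency_matrix G vs"
abbreviation "n \<equiv> length vs"

lemma d_pos: "0 < d"
  using g_ge_3 d by linarith

lemma vs_verts: "i < n \<Longrightarrow> vs ! i \<in> verts G"
  using vs by (metis nth_mem)

lemma sum_nth_vs: "(\<Sum>i<n. h (vs ! i)) = (\<Sum>u\<in>verts G. h u)"
  using sum.reindex_bij_betw[OF bij_betw_nth[OF vs(1) refl vs(2)[symmetric]], of h]
  by simp

lemma gdist_le_d: "u \<in> verts G \<Longrightarrow> v \<in> verts G \<Longrightarrow> f u v \<le> d"
  using moore_sum_nbrs_odd(1)[OF _ card_moore] moore_sum_nbrs_even(1)[OF _ card_moore] d
  by (cases "even g") (auto elim!: evenE oddE)

lemma sum_nbrs:
  assumes uv: "u \<in> verts G" "v \<in> verts G"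
  shows "(\<Sum>w\<in>nbrs u. \<eta> (f w v)) = nbr_sum \<eta> (f u v)"
proof -
  consider "f u v = 0" | "0 < f u v" "f u v < d" | "f u v = d" "f u v > 0"
    using gdist_le_d[OF uv] by linarith
  then show ?thesis
  proof cases
    case 1
    then have "u = v" using gdist_eq_0_iff[OF reach[OF uv]] by simp
    then show ?thesis using sum_nbrs_root[OF uv(2), of \<eta>] 1 by (simp add: nbr_sum_def)
  next
    case 2
    then obtain i where i: "f u v = Suc i" by (cases "f u v") auto
    then have "Suc i < g div 2" using 2 d by simp
    then have "2 * Suc i + 1 < g" by presburger
    from sum_nbrs_interior(1)[OF uv i this, of \<eta>] show ?thesis using 2 i by (simp add: nbr_sum_def)
  next
    case 3
    show ?thesis
    proof (cases "even g")
      case True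
      then have "g = 2 * d" using d by auto
      from moore_sum_nbrs_even(2)[OF this card_moore uv 3(1), of \<eta>] show ?thesis
        using 3 True by (simp add: nbr_sum_def)
    next
      case False
      then have "g = 2 * d + 1" using d by (auto elim!: oddE)
      from moore_sum_nbrs_odd(2)[OF this card_moore uv 3(1), of \<eta>] show ?thesis
        using 3 False by (simp add: nbr_sum_def)
    qed
  qed
qed

lemma A_carrier [simp]: "A \<in> carrier_mat n n"
  by (simp add: adjacency_matrix_def)

lemma A_dim [simp]: "dim_row A = n" "dim_col A = n"
  by (simp_all add: adjacency_matrix_def)

lemma A_entry: "i < n \<Longrightarrow> j < n \<Longrightarrow> A $$ (i, j) = (if vs ! j \<in> nbrs (vs ! i) then 1 else 0)"
  by (simp add: adjacency_matrix_def nbrs_def)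

lemma A_sym: "i < n \<Longrightarrow> j < n \<Longrightarrow> A $$ (i, j) = A $$ (j, i)"
  using nbrs_sym by (auto simp: A_entry)

lemma A_row_sum: "i < n \<Longrightarrow> (\<Sum>j<n. A $$ (i, j) * h (vs ! j)) = (\<Sum>w\<in>nbrs (vs ! i). h w)" for h :: "'a \<Rightarrow> real"
proof -
  assume i: "i < n"
  then have "(\<Sum>j<n. A $$ (i, j) * h (vs ! j)) = (\<Sum>j<n. if vs ! j \<in> nbrs (vs ! i) then h (vs ! j) else 0)"
    by (intro sum.cong refl) (auto simp: A_entry)
  also have "\<dots> = (\<Sum>w\<in>verts G. if w \<in> nbrs (vs ! i) then h w else 0)"
    by (rule sum_nth_vs)
  also have "\<dots> = (\<Sum>w\<in>nbrs (vs ! i). h w)"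
    using nbrs_verts by (simp add: sum.If_cases Int_absorb1)
  finally show ?thesis .
qed

lemma A_row_sum_1: "i < n \<Longrightarrow> (\<Sum>j<n. A $$ (i, j)) = k"
  using A_row_sum[of i "\<lambda>_. 1"] card_nbrs[OF vs_verts] by simp

lemma dmat_carrier [simp]: "dmat \<eta> \<in> carrier_mat n n"
  by (simp add: dmat_def)

lemma dmat_dim [simp]: "dim_row (dmat \<eta>) = n" "dim_col (dmat \<eta>) = n"
  by (simp_all add: dmat_def)

lemma dmat_entry [simp]: "i < n \<Longrightarrow> j < n \<Longrightarrow> dmat \<eta> $$ (i, j) = \<eta> (f (vs ! i) (vs ! j))"
  by (simp add: dmat_def)

lemma dmat_cong: "(\<And>t. t \<le> d \<Longrightarrow> \<eta> t = \<eta>' t) \<Longrightarrow> dmat \<eta> = dmat \<eta>'"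
  by (rule eq_matI) (auto intro!: gdist_le_d vs_verts)

lemma A_mult_dmat: "A * dmat \<eta> = dmat (nbr_sum \<eta>)"
proof (rule eq_matI)
  fix i j assume "i < dim_row (dmat (nbr_sum \<eta>))" "j < dim_col (dmat (nbr_sum \<eta>))"
  then have ij: "i < n" "j < n" by auto
  then have "(A * dmat \<eta>) $$ (i, j) = (\<Sum>l<n. A $$ (i, l) * \<eta> (f (vs ! l) (vs ! j)))"
    by (simp add: scalar_prod_def lessThan_atLeast0)
  also have "\<dots> = nbr_sum \<eta> (f (vs ! i) (vs ! j))"
    using A_row_sum[OF ij(1), of "\<lambda>w. \<eta> (f w (vs ! j))"] sum_nbrs[OF vs_verts vs_verts] ij by simp
  finally show "(A * dmat \<eta>) $$ (i, j) = dmat (nbr_sum \<eta>) $$ (i, j)" using ij by simp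
qed auto

lemma dmat_one: "1\<^sub>m n = dmat (\<lambda>t. if t = 0 then 1 else 0)"
  using vs(1) gdist_eq_0_iff[OF reach[OF vs_verts vs_verts]]
  by (intro eq_matI) (auto simp: nth_eq_iff_index_eq)

lemma distance_matrix_eq: "distance_matrix G vs = dmat real"
  by (intro eq_matI) (auto simp: distance_matrix_def graph_dist_eq_gdist reach vs_verts)

lemma dmat_add: "dmat \<eta> + dmat \<eta>' = dmat (\<lambda>t. \<eta> t + \<eta>' t)"
  by (intro eq_matI) auto

lemma dmat_smult: "c \<cdot>\<^sub>m dmat \<eta> = dmat (\<lambda>t. c * \<eta> t)"
  by (intro eq_matI) auto

lemma mat_poly_pCons_dmat:
  assumes "mat_poly A p = dmat \<eta>"
  shows "mat_poly A (pCons c p) = dmat (\<lambda>t. (if t = 0 then c else 0) + nbr_sum \<eta> t)"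
  unfolding mat_poly_pCons[OF A_carrier] assms A_mult_dmat dmat_one dmat_smult dmat_add
  by (intro arg_cong[of _ _ dmat] ext) auto

lemma mat_poly_zero_dmat: "mat_poly A 0 = dmat (\<lambda>_. 0)"
  unfolding mat_poly_0[OF A_carrier] by (intro eq_matI) auto

text \<open>The weight of the distance-\<open>i\<close> matrix, except for the factor
  \<open>k\<close> at \<open>i = d\<close>. For even girth all \<open>k\<close> neighbours of a
  vertex at distance \<open>d\<close> are closer, so the recurrence ends in \<open>k\<close> times
  that matrix, which \<open>real d / real k\<close> in \<open>dist_poly\<close> corrects.\<close>

definition "layer i t = (if t = i then if i < d then 1 else real k else 0)"

lemma mat_poly_F_poly:
  assumes g: "even g"
  shows "i \<le> d \<Longrightarrow> mat_poly A (F_poly k i) = dmat (layer i)"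
proof (induction i rule: less_induct)
  case (less i)
  have d2: "2 \<le> d" using g g_ge_3 d by (auto elim!: evenE)
  have one: "mat_poly A 1 = dmat (layer 0)"
    unfolding one_pCons mat_poly_pCons_dmat[OF mat_poly_zero_dmat]
    by (rule dmat_cong) (use d2 in \<open>auto simp: nbr_sum_def layer_def\<close>)
  consider "i = 0" | "i = 1" | j where "i = j + 2" by (metis add_2_eq_Suc' not0_implies_Suc One_nat_def)
  then show ?case
  proof cases
    case 1
    then show ?thesis using one by simp
  next
    case 2
    have "[:0, 1:] = pCons 0 (1 :: real poly)" by (simp add: one_pCons)
    then show ?thesis unfolding 2 One_nat_def F_poly_1 \<open>[:0, 1:] = _\<close> mat_poly_pCons_dmat[OF one]
      by (intro dmat_cong) (use d2 g in \<open>auto simp: nbr_sum_def layer_def\<close>)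
  next
    case (3 j)
    define r where "r = (if j = 0 then real k else real k - 1)"
    have p: "F_poly k i = pCons 0 (F_poly k (j + 1)) + Polynomial.smult (- r) (F_poly k j)"
      unfolding 3 r_def F_poly_Suc_Suc by simp
    have IH: "mat_poly A (F_poly k (j + 1)) = dmat (layer (j + 1))" "mat_poly A (F_poly k j) = dmat (layer j)"
      using less 3 by auto
    show ?thesis
      unfolding p mat_poly_add[OF A_carrier] mat_poly_pCons_dmat[OF IH(1)] mat_poly_smult[OF A_carrier] IH(2)
        dmat_add dmat_smult
    proof (rule dmat_cong)
      fix t assume "t \<le> d"
      then show "(if t = 0 then 0 else 0) + nbr_sum (layer (j + 1)) t + - r * layer j t = layer i t"
        unfolding nbr_sum_def layer_def r_def using 3 less.prems g by auto
    qed
  qed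
qed

lemma distance_matrix_even:
  assumes g: "even g"
  shows "distance_matrix G vs = mat_poly A (dist_poly k g)"
proof -
  have gd: "g = 2 * d" using g d by auto
  have "mat_poly A (\<Sum>i<m. Polynomial.smult (real i) (F_poly k i)) = dmat (\<lambda>t. if t < m then real t else 0)"
    if "m \<le> d" for m
    using that
  proof (induction m)
    case 0
    then show ?case by (simp add: mat_poly_zero_dmat)
  next
    case (Suc m)
    then have IH: "mat_poly A (\<Sum>i<m. Polynomial.smult (real i) (F_poly k i)) = dmat (\<lambda>t. if t < m then real t else 0)"
      by simp
    show ?case
      unfolding sum.lessThan_Suc mat_poly_add[OF A_carrier] mat_poly_smult[OF A_carrier] IH
        mat_poly_F_poly[OF g Suc_leD[OF Suc.prems]] dmat_add dmat_smult
      by (rule dmat_cong) (use Suc.prems in \<open>auto simp: layer_def\<close>)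
  qed
  from this[OF order_refl] show ?thesis
    unfolding dist_poly_even[OF gd] mat_poly_add[OF A_carrier] mat_poly_smult[OF A_carrier] distance_matrix_eq
      mat_poly_F_poly[OF g order_refl] 
    by (simp only: dmat_add dmat_smult) (rule dmat_cong, use k_ge_2 in \<open>auto simp: layer_def\<close>)
qed

lemma distance_matrix_girth_3:
  assumes g: "g = 3"
  shows "distance_matrix G vs = mat_poly A (dist_poly k g)"
proof -
  have "dist_poly k g = [:0, 1:]" using g by (simp add: dist_poly_def)
  then show ?thesis
    unfolding \<open>_ = [:0, 1:]\<close> distance_matrix_eq mat_poly_pCons_dmat[OF mat_poly_pCons_dmat[OF mat_poly_zero_dmat]]
    unfolding nbr_sum_def by (intro dmat_cong) (use g d in auto)
qed

text \<open>Distinct vertices have a common neighbour exactly if they are at distance 2, and then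
  only one; so the square of \<open>A\<close> minus \<open>k\<close> times the identity is the
  distance-2 matrix.\<close>

lemma distance_matrix_girth_5:
  assumes g: "g = 5"
  shows "distance_matrix G vs = mat_poly A (dist_poly k g)"
proof -
  have "dist_poly k g = [:- 2 * real k, 1, 2:]" using g by (simp add: dist_poly_def)
  then show ?thesis
    unfolding \<open>_ = [:- 2 * real k, 1, 2:]\<close> distance_matrix_eq
      mat_poly_pCons_dmat[OF mat_poly_pCons_dmat[OF mat_poly_pCons_dmat[OF mat_poly_zero_dmat]]]
  proof (intro dmat_cong)
    fix t assume "t \<le> d"
    then have "t = 0 \<or> t = 1 \<or> t = 2" using g d by auto
    then show "real t = (if t = 0 then - 2 * real k else 0) + nbr_sum (\<lambda>t. (if t = 0 then 1 else 0)
        + nbr_sum (\<lambda>t. (if t = 0 then 2 else 0) + nbr_sum (\<lambda>_. 0) t) t) t"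
      unfolding nbr_sum_def using g d by auto
  qed
qed

end

section \<open>Injectivity on the spectrum\<close>

context moore_graph
begin

abbreviation "pf \<equiv> dist_poly k g"

section \<open>Eigenvectors of the adjacency matrix and the relations they impose\<close>

lemma A_mult_vec_entry:
  assumes "v \<in> carrier_vec n" "i < n" "A *\<^sub>v v = x \<cdot>\<^sub>v v"
  shows "(\<Sum>j<n. A $$ (i, j) * v $ j) = x * v $ i"
  using arg_cong[OF assms(3), of "\<lambda>w. w $ i"] assms(1,2) by (simp add: scalar_prod_def lessThan_atLeast0)

lemma dmat_mult_vec_entry:
  assumes "v \<in> carrier_vec n" "i < n"
  shows "(dmat \<eta> *\<^sub>v v) $ i = (\<Sum>j<n. \<eta> (f (vs ! i) (vs ! j)) * v $ j)"
  using assms by (simp add: scalar_prod_def lessThan_atLeast0)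

lemma eigenvalue_nonzero_entry:
  assumes "eigenvalue A x"
  obtains v i where "v \<in> carrier_vec n" "A *\<^sub>v v = x \<cdot>\<^sub>v v" "i < n" "v $ i \<noteq> 0"
proof -
  obtain v where v: "v \<in> carrier_vec n" "v \<noteq> 0\<^sub>v n" "A *\<^sub>v v = x \<cdot>\<^sub>v v"
    using assms by (auto simp: eigenvalue_def eigenvector_def)
  then obtain i where "i < n" "v $ i \<noteq> 0" by (metis carrier_vecD eq_vecI index_zero_vec(1,2))
  with v that show thesis by blast
qed

text \<open>Compare both sides of the eigenvalue equation at a coordinate of largest absolute value;
  the rows of \<open>A\<close> are nonnegative with sum \<open>k\<close>.\<close>

lemma eigenvalue_abs_le:
  assumes "eigenvalue A x"
  shows "\<bar>x\<bar> \<le> k"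
proof -
  obtain v i where v: "v \<in> carrier_vec n" "A *\<^sub>v v = x \<cdot>\<^sub>v v" "i < n" "v $ i \<noteq> 0"
    using eigenvalue_nonzero_entry[OF assms] .
  define m where "m = Max ((\<lambda>j. \<bar>v $ j\<bar>) ` {..<n})"
  have "m \<in> (\<lambda>j. \<bar>v $ j\<bar>) ` {..<n}" unfolding m_def using v(3) by (intro Max_in) auto
  then obtain l where l: "l < n" "m = \<bar>v $ l\<bar>" by auto
  have le: "\<bar>v $ j\<bar> \<le> m" if "j < n" for j unfolding m_def using that by (intro Max_ge) auto
  have "m > 0" using le[OF v(3)] v(4) by linarith
  have "\<bar>x\<bar> * m = \<bar>\<Sum>j<n. A $$ (l, j) * v $ j\<bar>"
    using A_mult_vec_entry[OF v(1) l(1) v(2)] l by (simp add: abs_mult)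
  also have "\<dots> \<le> (\<Sum>j<n. A $$ (l, j) * m)"
    by (intro order.trans[OF sum_abs] sum_mono) (auto simp: abs_mult A_entry l(1) le)
  also have "\<dots> = k * m"
    using A_row_sum_1[OF l(1)] by (simp add: sum_distrib_right[symmetric])
  finally show ?thesis using \<open>m > 0\<close> by simp
qed

lemma eigenvector_sum_zero:
  assumes v: "v \<in> carrier_vec n" "A *\<^sub>v v = x \<cdot>\<^sub>v v" and x: "x \<noteq> k"
  shows "(\<Sum>j<n. v $ j) = 0"
proof -
  have "x * (\<Sum>j<n. v $ j) = (\<Sum>i<n. \<Sum>j<n. A $$ (i, j) * v $ j)"
    using A_mult_vec_entry[OF v(1) _ v(2)] by (simp add: sum_distrib_left)
  also have "\<dots> = (\<Sum>j<n. (\<Sum>i<n. A $$ (j, i)) * v $ j)"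
    by (subst sum.swap) (auto simp: sum_distrib_right A_sym intro!: sum.cong)
  also have "\<dots> = k * (\<Sum>j<n. v $ j)"
    by (simp add: A_row_sum_1 sum_distrib_left)
  finally show ?thesis using x by simp
qed

text \<open>
  The value at \<open>k\<close> is the common row sum of the distance matrix. Comparing a row at a largest
  coordinate of an eigenvector for it shows that the eigenvector is constant.
\<close>

lemma dist_poly_degree_inj:
  assumes D: "distance_matrix G vs = mat_poly A pf"
    and ev: "eigenvalue A x" and eq: "poly pf x = poly pf k"
  shows "x = k"
proof -
  obtain v i where v: "v \<in> carrier_vec n" "A *\<^sub>v v = x \<cdot>\<^sub>v v" "i < n" "v $ i \<noteq> 0"
    using eigenvalue_nonzero_entry[OF ev] .
  define e where "e = vec n (\<lambda>_. 1 :: real)"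
  have e: "e \<in> carrier_vec n" by (simp add: e_def)
  have Ae: "A *\<^sub>v e = real k \<cdot>\<^sub>v e"
    by (intro eq_vecI) (auto simp: e_def scalar_prod_def lessThan_atLeast0[symmetric] A_row_sum_1)
  have De: "dmat real *\<^sub>v e = poly pf k \<cdot>\<^sub>v e"
    using mat_poly_mult_eigenvector[OF A_carrier e Ae, of pf] D by (simp add: distance_matrix_eq)
  have Dv: "dmat real *\<^sub>v v = poly pf k \<cdot>\<^sub>v v"
    using mat_poly_mult_eigenvector[OF A_carrier v(1,2), of pf] D eq by (simp add: distance_matrix_eq)
  have rowsum: "(\<Sum>j<n. real (f (vs ! l) (vs ! j))) = poly pf k" if "l < n" for l
    using arg_cong[OF De, of "\<lambda>w. w $ l"] dmat_mult_vec_entry[OF e that, of real] that by (simp add: e_def)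
  define m where "m = Max ((\<lambda>j. v $ j) ` {..<n})"
  have "m \<in> (\<lambda>j. v $ j) ` {..<n}" unfolding m_def using v(3) by (intro Max_in) auto
  then obtain l where l: "l < n" "m = v $ l" by auto
  have le: "v $ j \<le> m" if "j < n" for j unfolding m_def using that by (intro Max_ge) auto
  have "(\<Sum>j<n. real (f (vs ! l) (vs ! j)) * v $ j) = poly pf k * v $ l"
    using arg_cong[OF Dv, of "\<lambda>w. w $ l"] dmat_mult_vec_entry[OF v(1) l(1), of real] l v(1) by simp
  then have "(\<Sum>j<n. real (f (vs ! l) (vs ! j)) * (m - v $ j)) = 0"
    using rowsum[OF l(1)] l(2) by (simp add: right_diff_distrib sum_subtractf sum_distrib_right[symmetric])
  then have zero: "real (f (vs ! l) (vs ! j)) * (m - v $ j) = 0" if "j < n" for j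
    using le that by (subst (asm) sum_nonneg_eq_0_iff) auto
  have const: "v $ j = m" if "j < n" for j
  proof (cases "vs ! l = vs ! j")
    case True
    then show ?thesis using l that vs(1) by (simp add: nth_eq_iff_index_eq)
  next
    case False
    then have "f (vs ! l) (vs ! j) \<noteq> 0" using gdist_eq_0_iff[OF reach[OF vs_verts vs_verts]] l that by simp
    then show ?thesis using zero[OF that] by simp
  qed
  have "m \<noteq> 0" using const v by auto
  have "(\<Sum>j<n. A $$ (i, j) * v $ j) = k * m"
    using A_row_sum_1[OF v(3)] const by (simp add: sum_distrib_right[symmetric])
  then show "x = k" using A_mult_vec_entry[OF v(1,3,2)] const[OF v(3)] \<open>m \<noteq> 0\<close> by simp
qed

text \<open>Reading a matrix identity at a row where \<open>v\<close> does not vanish turns it into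
  a scalar identity for \<open>x\<close>.\<close>

lemma dmat_mult_eigenvector:
  assumes v: "v \<in> carrier_vec n" "A *\<^sub>v v = x \<cdot>\<^sub>v v" "i < n" "v $ i \<noteq> 0"
    and p: "mat_poly A p = dmat \<eta>"
  shows "(\<Sum>j<n. \<eta> (f (vs ! i) (vs ! j)) * v $ j) = poly p x * v $ i"
  using arg_cong[OF mat_poly_mult_eigenvector[OF A_carrier v(1,2), of p], of "\<lambda>w. w $ i"]
    dmat_mult_vec_entry[OF v(1,3), of \<eta>] p v by simp

text \<open>The first relation reflects that a vertex at distance \<open>d - 1\<close> has
  \<open>k - 1\<close> neighbours at distance \<open>d\<close>. For the second, \<open>A\<close>
  times the distance matrix minus \<open>k\<close> times it is, up to multiples of the identity and
  of the distance-\<open>d\<close> matrix, a multiple of the all-ones matrix, which annihilates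
  eigenvectors for \<open>x \<noteq> k\<close>.\<close>

lemma eigenvalue_relations_even:
  assumes g: "even g" and ev: "eigenvalue A x"
  shows "x * poly (F_poly k d) x = (real k - 1) * k * poly (F_poly k (d - 1)) x"
    and "x \<noteq> k \<Longrightarrow> (x - k) * poly pf x = 2 - 2 * (real k - 1) / k * poly (F_poly k d) x"
proof -
  have d2: "2 \<le> d" using g g_ge_3 d by (auto elim!: evenE)
  obtain v i where v: "v \<in> carrier_vec n" "A *\<^sub>v v = x \<cdot>\<^sub>v v" "i < n" "v $ i \<noteq> 0"
    using eigenvalue_nonzero_entry[OF ev] .
  note rel = dmat_mult_eigenvector[OF v]
  let ?p = "Polynomial.smult ((real k - 1) * k) (F_poly k (d - 1))"
  define \<eta> where "\<eta> t = (if t = d - 1 then (real k - 1) * k else 0)" for t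
  have 1: "mat_poly A (pCons 0 (F_poly k d)) = dmat \<eta>"
    unfolding mat_poly_pCons_dmat[OF mat_poly_F_poly[OF g order_refl]] nbr_sum_def layer_def \<eta>_def
    by (rule dmat_cong) (use d2 g in auto)
  have 2: "mat_poly A ?p = dmat \<eta>"
    unfolding mat_poly_smult[OF A_carrier] mat_poly_F_poly[OF g diff_le_self] dmat_smult layer_def \<eta>_def
    by (rule dmat_cong) (use d2 in auto)
  have "poly (pCons 0 (F_poly k d)) x * v $ i = poly ?p x * v $ i"
    by (rule trans[OF rel[OF 1, symmetric] rel[OF 2]])
  then show "x * poly (F_poly k d) x = (real k - 1) * k * poly (F_poly k (d - 1)) x"
    using v(4) by simp
  assume x: "x \<noteq> k"
  have D: "mat_poly A pf = dmat real" using distance_matrix_even[OF g] distance_matrix_eq by simp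
  have one: "mat_poly A 1 = dmat (layer 0)" using mat_poly_F_poly[OF g, of 0] by simp
  \<comment> \<open>Without the last two summands the weight is \<open>k\<close> at 0,
    \<open>k - 2\<close> strictly between and \<open>- k\<close> at \<open>d\<close>; these summands
    level it to \<open>k - 2\<close>.\<close>
  define p where "p = pCons 0 pf + Polynomial.smult (- real k) pf + Polynomial.smult (- 2) 1
    + Polynomial.smult (2 * (real k - 1) / k) (F_poly k d)"
  have "mat_poly A p = dmat (\<lambda>_. real k - 2)"
    unfolding p_def mat_poly_add[OF A_carrier] mat_poly_smult[OF A_carrier] mat_poly_pCons_dmat[OF D] D one
      mat_poly_F_poly[OF g order_refl] dmat_smult dmat_add
  proof (rule dmat_cong)
    fix t assume t: "t \<le> d"
    have k: "real k \<noteq> 0" using k_ge_2 by simp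
    consider "t = 0" | "0 < t" "t < d" | "t = d" using t by linarith
    then show "(if t = 0 then 0 else 0) + nbr_sum real t + - real k * real t + - 2 * layer 0 t
        + 2 * (real k - 1) / real k * layer d t = real k - 2"
      unfolding nbr_sum_def layer_def using d2 g k
      by cases (auto simp: field_simps of_nat_diff)
  qed
  from rel[OF this] have "poly p x * v $ i = (real k - 2) * (\<Sum>j<n. v $ j)"
    by (simp add: sum_distrib_left)
  then have "poly p x = 0" using eigenvector_sum_zero[OF v(1,2) x] v(4) by simp
  then show "(x - k) * poly pf x = 2 - 2 * (real k - 1) / k * poly (F_poly k d) x"
    by (simp add: p_def algebra_simps)
qed

lemma dist_poly_eigenvalue_girth_5:
  assumes g: "g = 5" and ev: "eigenvalue A x" and x: "x \<noteq> k"
  shows "poly pf x = - 2 - x"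
proof -
  obtain v i where v: "v \<in> carrier_vec n" "A *\<^sub>v v = x \<cdot>\<^sub>v v" "i < n" "v $ i \<noteq> 0"
    using eigenvalue_nonzero_entry[OF ev] .
  have D: "mat_poly A pf = dmat real" using distance_matrix_girth_5[OF g] distance_matrix_eq by simp
  have p: "mat_poly A (pf + [:2, 1:]) = dmat (\<lambda>_. 2)"
    unfolding mat_poly_add[OF A_carrier] D mat_poly_pCons_dmat[OF mat_poly_pCons_dmat[OF mat_poly_zero_dmat]] dmat_add
  proof (rule dmat_cong)
    fix t assume "t \<le> d"
    then have "t = 0 \<or> t = 1 \<or> t = 2" using g d by auto
    then show "real t + ((if t = 0 then 2 else 0) + nbr_sum (\<lambda>t. (if t = 0 then 1 else 0) + nbr_sum (\<lambda>_. 0) t) t) = 2"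
      unfolding nbr_sum_def using g d by auto
  qed
  from dmat_mult_eigenvector[OF v p] have "poly (pf + [:2, 1:]) x * v $ i = 2 * (\<Sum>j<n. v $ j)"
    by (simp add: sum_distrib_left)
  then have "poly (pf + [:2, 1:]) x = 0" using eigenvector_sum_zero[OF v(1,2) x] v(4) by simp
  then show ?thesis by simp
qed

section \<open>Separating the values of \<open>dist_poly\<close> at distinct eigenvalues\<close>

lemma A_int: "i < n \<Longrightarrow> j < n \<Longrightarrow> A $$ (i, j) \<in> \<int>"
  by (simp add: A_entry)

text \<open>For even girth and an eigenvalue \<open>x\<close>, this is \<open>k - 1\<close> times
  the eigenvalue of the distance-\<open>d\<close> matrix, scaled so that its square becomes
  \<open>(real k - 1) ^ d\<close>.\<close>

definition "w_val x = (real k - 1) / k * poly (F_poly k d) x"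

lemma degree_pos: "0 < real k" "0 < real k - 1"
  using k_ge_2 by simp_all

lemma eigenvalue_less:
  assumes "eigenvalue A x" "x \<noteq> k"
  shows "x < k"
  using eigenvalue_abs_le[OF assms(1)] assms(2) by linarith

lemma w_val_eq:
  assumes "even g" "eigenvalue A x" "x \<noteq> k"
  shows "(real k - x) * poly pf x = 2 * w_val x - 2"
  using eigenvalue_relations_even(2)[OF assms] by (simp add: w_val_def algebra_simps)

lemma w_val_mult:
  assumes "even g" "eigenvalue A x"
  shows "x * w_val x = (real k - 1)\<^sup>2 * poly (F_poly k (d - 1)) x"
proof -
  have "x * w_val x = (real k - 1) / k * (x * poly (F_poly k d) x)" by (simp add: w_val_def)
  also have "\<dots> = (real k - 1)\<^sup>2 * poly (F_poly k (d - 1)) x"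
    unfolding eigenvalue_relations_even(1)[OF assms] using degree_pos by (simp add: power2_eq_square)
  finally show ?thesis .
qed

lemma w_val_square:
  assumes g: "even g" and x: "eigenvalue A x" "x \<noteq> k" "x \<noteq> - real k"
  shows "(w_val x)\<^sup>2 = (real k - 1) ^ d"
proof -
  have d2: "2 \<le> d" using g g_ge_3 d by (auto elim!: evenE)
  then obtain i where i: "d = i + 2" by (metis add.commute le_Suc_ex)
  have "x\<^sup>2 \<noteq> (real k)\<^sup>2" using x by (simp add: power2_eq_iff)
  then have "(poly (F_poly k d) x)\<^sup>2 = (real k)\<^sup>2 * (real k - 1) ^ i"
    using F_poly_square[OF k_ge_2, of x i] eigenvalue_relations_even(1)[OF g x(1)] i by simp
  then show ?thesis unfolding w_val_def power_mult_distrib power_divide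
    using degree_pos i by (simp add: power2_eq_square)
qed

lemma w_val_neg_degree:
  assumes "even g"
  shows "w_val (- real k) = (-1) ^ d * (real k - 1) ^ d"
proof -
  obtain i where "d = Suc i" using d_pos by (cases d) auto
  then show ?thesis unfolding w_val_def using poly_F_poly_neg_degree[of k i] degree_pos by simp
qed

text \<open>The graph is complete bipartite. For \<open>d = 2\<close> the polynomial
  \<open>F_poly k (d - 1)\<close> is \<open>x\<close>, so a nonzero \<open>x\<close> cancels from
  \<open>w_val_mult\<close>, and the value found gives
  \<open>x\<^sup>2 = (real k)\<^sup>2\<close>.\<close>

lemma girth_4_eigenvalue:
  assumes d2: "d = 2" and g: "even g" and x: "eigenvalue A x" "x \<noteq> k" "x \<noteq> - real k"
  shows "x = 0" "w_val x = 1 - real k"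
proof -
  have "poly (F_poly k d) x = x * x - real k"
    using poly_F_poly_Suc_Suc[of k 0 x] d2 by (simp add: numeral_2_eq_2)
  then have w: "real k * w_val x = (real k - 1) * (x * x - real k)"
    using degree_pos by (simp add: w_val_def)
  show "x = 0"
  proof (rule ccontr)
    assume "x \<noteq> 0"
    moreover have "x * w_val x = (real k - 1)\<^sup>2 * x" using w_val_mult[OF g x(1)] d2 by simp
    ultimately have W: "w_val x = (real k - 1) * (real k - 1)" by (simp add: power2_eq_square)
    have "(real k - 1) * (real k * (real k - 1)) = (real k - 1) * (x * x - real k)"
      using w unfolding W by (simp only: mult_ac)
    then have "real k * (real k - 1) = x * x - real k" using degree_pos by simp
    then have "x\<^sup>2 = (real k)\<^sup>2" by (simp add: power2_eq_square algebra_simps)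
    then show False using x by (simp add: power2_eq_iff)
  qed
  then have "real k * w_val x = real k * (1 - real k)" using w by (simp add: algebra_simps)
  then show "w_val x = 1 - real k" using degree_pos by simp
qed

text \<open>The sign of \<open>w_val (- real k)\<close> alternates with \<open>d\<close>, so the
  parity of \<open>d\<close> decides which arithmetic obstruction applies; for \<open>d = 2\<close>
  the signs of the two values already differ or one is zero.\<close>

lemma neg_degree_no_collision:
  assumes g: "even g" and kg: "3 \<le> k \<or> g \<le> 6"
    and ev: "eigenvalue A (- real k)" "eigenvalue A y" and y: "y \<noteq> k" "y \<noteq> - real k"
    and eq: "poly pf (- real k) = poly pf y"
  shows False
proof -
  define q where "q = k - 1"
  have q: "real k = real q + 1" "1 \<le> q" using k_ge_2 by (auto simp: q_def)
  have d2: "2 \<le> d" using g g_ge_3 d by (auto elim!: evenE)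
  have P: "real k * poly pf y = (-1) ^ d * real q ^ d - 1"
  proof -
    have "(real k - - real k) * poly pf y = 2 * ((-1) ^ d * (real k - 1) ^ d) - 2"
      using w_val_eq[OF g ev(1)] degree_pos unfolding eq w_val_neg_degree[OF g] by simp
    then show ?thesis using q by (simp add: algebra_simps)
  qed
  have w: "(real k - y) * poly pf y = 2 * w_val y - 2" "(w_val y)\<^sup>2 = real q ^ d"
    using w_val_eq[OF g ev(2) y(1)] w_val_square[OF g ev(2) y] q by auto
  have yk: "y < real q + 1" using eigenvalue_less[OF ev(2) y(1)] q by simp
  have int: "y \<in> \<rat> \<Longrightarrow> y \<in> \<int>"
    by (rule int_mat_eigenvalue(1)[OF A_carrier _ ev(2)]) (rule A_int)
  consider "d = 2" | e where "d = 2 * e" "2 \<le> e" | e where "d = 2 * e + 1" "1 \<le> e"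
  proof (cases "even d")
    case True
    then obtain e where "d = 2 * e" by auto
    then show ?thesis using that(1,2) d2 by (cases "e = 1") auto
  next
    case False
    then obtain e where "d = 2 * e + 1" by (auto elim: oddE)
    then show ?thesis using that(3) d2 by auto
  qed
  then show False
  proof cases
    case 1
    have "y = 0" "w_val y = 1 - real k" using girth_4_eigenvalue[OF 1 g ev(2) y] by auto
    then have "real k * poly pf y = - 2 * real k" using w(1) by simp
    moreover have "0 \<le> real q ^ 2 - 1" using q(2) by simp
    ultimately show False using P 1 degree_pos by simp
  next
    case (2 e)
    \<comment> \<open>Here \<open>d \<ge> 4\<close>, so \<open>g \<ge> 8\<close> and
      \<open>kg\<close> forces \<open>3 \<le> k\<close>.\<close>
    then have "2 \<le> q" using kg d g q by (auto simp: q_def)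
    from no_collision_with_neg_degree_even[OF this 2(2) yk, of "poly pf y" "w_val y"] show False
      using P w int 2(1) q(1) by simp
  next
    case (3 e)
    have "algebraic_int (sqrt (real q))"
      by (intro algebraic_int_sqrt int_imp_algebraic_int) simp
    then have "sqrt (real q) \<in> \<rat> \<Longrightarrow> sqrt (real q) \<in> \<int>"
      by (rule rational_algebraic_int_is_int)
    moreover have "a - b * sqrt (real q) \<le> real q + 1"
      if "y = a + b * sqrt (real q)" "a \<in> \<rat>" "b \<in> \<rat>" "sqrt (real q) \<notin> \<rat>" for a b
      proof -
      have "eigenvalue A (a - b * sqrt (real q))"
        by (rule int_mat_eigenvalue(2)[OF A_carrier _ ev(2) that]) (rule A_int)
      from eigenvalue_abs_le[OF this] q show ?thesis by simp
    qed
    ultimately show False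
      using no_collision_with_neg_degree_odd[OF q(2) 3(2) yk, of "poly pf y" "w_val y"] P w int 3(1) y(2) q(1) by simp
  qed
qed

text \<open>For \<open>k = 2\<close> the square of \<open>w_val\<close> is only 1, out of reach of
  \<open>eigenvalue_eq_if_square_eq\<close>; on the 6-cycle the two remaining eigenvalues and their
  images are computed explicitly.\<close>

lemma hexagon_no_collision:
  assumes "k = 2" and g: "even g" and d3: "d = 3"
    and x: "eigenvalue A x" "x \<noteq> k" "x \<noteq> - real k" and y: "eigenvalue A y" "y \<noteq> k" "y \<noteq> - real k"
    and eq: "poly pf x = poly pf y"
  shows "x = y"
proof -
  have cases: "(z = 1 \<and> poly pf z = - 4) \<or> (z = - 1 \<and> poly pf z = 0)"
    if z: "eigenvalue A z" "z \<noteq> k" "z \<noteq> - real k" for z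
  proof -
    have "poly (F_poly k (d - 1)) z = z * z - 2"
      using poly_F_poly_Suc_Suc[of k 0 z] d3 \<open>k = 2\<close> by (simp add: numeral_2_eq_2)
    then have zw: "z * w_val z = z * z - 2" using w_val_mult[OF g z(1)] \<open>k = 2\<close> by simp
    have P: "(2 - z) * poly pf z = 2 * w_val z - 2" using w_val_eq[OF g z(1,2)] \<open>k = 2\<close> by simp
    have "(w_val z)\<^sup>2 = 1" using w_val_square[OF g z] \<open>k = 2\<close> by simp
    then consider "w_val z = 1" | "w_val z = - 1" by (auto simp: power2_eq_1_iff)
    then show ?thesis
    proof cases
      case 1
      then have "(z - 2) * (z + 1) = 0" using zw by (simp add: algebra_simps)
      then have "z = - 1" using z \<open>k = 2\<close> by simp
      then show ?thesis using P 1 by simp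
    next
      case 2
      then have "(z + 2) * (z - 1) = 0" using zw by (simp add: algebra_simps)
      then have "z = 1" using z \<open>k = 2\<close> by (simp add: eq_neg_iff_add_eq_0)
      then show ?thesis using P 2 by simp
    qed
  qed
  from cases[OF x] cases[OF y] eq show ?thesis by auto
qed

lemma dist_poly_inj_even:
  assumes g: "even g" and kg: "3 \<le> k \<or> g \<le> 6"
    and ev: "eigenvalue A x" "eigenvalue A y" and eq: "poly pf x = poly pf y"
  shows "x = y"
proof -
  have d2: "2 \<le> d" using g g_ge_3 d by (auto elim!: evenE)
  note D = distance_matrix_even[OF g]
  consider "x = k \<or> y = k" | "x \<noteq> k" "y \<noteq> k" "x = - real k \<or> y = - real k"
    | "x \<noteq> k" "y \<noteq> k" "x \<noteq> - real k" "y \<noteq> - real k" by blast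
  then show ?thesis
  proof cases
    case 1
    then show ?thesis using dist_poly_degree_inj[OF D ev(1)] dist_poly_degree_inj[OF D ev(2)] eq by auto
  next
    case 2
    show ?thesis
    proof (cases "x = - real k")
      case True
      show ?thesis
      proof (rule ccontr)
        assume "x \<noteq> y"
        then show False using neg_degree_no_collision[OF g kg, of y] ev eq 2 True by simp
      qed
    next
      case False
      then have "y = - real k" using 2 by simp
      then show ?thesis using neg_degree_no_collision[OF g kg, of x] ev eq 2 False by simp
    qed
  next
    case 3
    show ?thesis
    \<comment> \<open>The bound \<open>1 < (real k - 1) ^ d\<close> fails for \<open>k = 2\<close>,
      where \<open>kg\<close> leaves only the 4-cycle and the 6-cycle.\<close>
    proof (cases "k = 2")
      case True
      then have "d \<le> 3" using kg d by auto
      then consider "d = 2" | "d = 3" using d2 by linarith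
      then show ?thesis
      proof cases
        case 1
        then show ?thesis using girth_4_eigenvalue(1)[OF 1 g ev(1) 3(1,3)] girth_4_eigenvalue(1)[OF 1 g ev(2) 3(2,4)] by simp
      qed (use hexagon_no_collision[OF True g _ ev(1) 3(1,3) ev(2) 3(2,4) eq] in simp)
    next
      case False
      then have "1 < real k - 1" using k_ge_2 by simp
      then have "1 < (real k - 1) ^ d" using d_pos by (intro one_less_power) auto
      from eigenvalue_eq_if_square_eq[OF eigenvalue_less[OF ev(1) 3(1)] eigenvalue_less[OF ev(2) 3(2)]
          w_val_eq[OF g ev(1) 3(1)] w_val_eq[OF g ev(2) 3(2), folded eq]
          w_val_square[OF g ev(1) 3(1,3)] w_val_square[OF g ev(2) 3(2,4)] this]
      show ?thesis .
    qed
  qed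
qed

lemma dist_poly_inj:
  assumes g: "even g \<or> g = 3 \<or> g = 5" and kg: "3 \<le> k \<or> g \<le> 6"
    and ev: "eigenvalue A x" "eigenvalue A y" and eq: "poly pf x = poly pf y"
  shows "x = y"
proof -
  consider "even g" | "g = 3" | "g = 5" using g by blast
  then show ?thesis
  proof cases
    case 1
    then show ?thesis using dist_poly_inj_even[OF _ kg ev eq] by simp
  next
    case 2
    then have "dist_poly k g = [:0, 1:]" by (simp add: dist_poly_def)
    then show ?thesis using eq by simp
  next
    case 3
    note inj = dist_poly_degree_inj[OF distance_matrix_girth_5[OF 3]]
    consider "x = k" | "y = k" | "x \<noteq> k" "y \<noteq> k" by blast
    then show ?thesis
    proof cases
      case 1
      then show ?thesis using inj[OF ev(2)] eq by simp
    next
      case 2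
      then show ?thesis using inj[OF ev(1)] eq by simp
    next
      case n: 3
      show ?thesis using eq unfolding dist_poly_eigenvalue_girth_5[OF 3 ev(1) n(1)] dist_poly_eigenvalue_girth_5[OF 3 ev(2) n(2)] by simp
    qed
  qed
qed

lemma distance_matrix_eq_mat_poly:
  "even g \<or> g = 3 \<or> g = 5 \<Longrightarrow> distance_matrix G vs = mat_poly A pf"
  using distance_matrix_even distance_matrix_girth_3 distance_matrix_girth_5 by blast

end

text \<open>The sum covers the cases where \<open>dist_poly\<close> is not injective on the
  spectrum: for \<open>k = 2\<close> and even \<open>g \<ge> 8\<close> the graph is a cycle, and
  several of its eigenvalues are sent to 0. The condition \<open>3 \<le> k \<or> g \<le> 6\<close>
  excludes exactly these cycles, and the sum then has the single term at \<open>l\<close>.\<close>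

theorem theorem2p3:
  fixes G :: "('a, 'b) pre_digraph" and vs :: "'a list" and k g :: nat and l :: real
  assumes "minimal_cage k g G"
    and "even g \<or> g = 3 \<or> g = 5"
    and "distinct vs" and "set vs = verts G"
    and "eigenvalue (adjacency_matrix G vs) l"
  shows "eigenvalue (distance_matrix G vs) (poly (dist_poly k g) l)
    \<and> (3 \<le> k \<or> g \<le> 6 \<longrightarrow>
         multiplicity_of (distance_matrix G vs) (poly (dist_poly k g) l)
           = multiplicity_of (adjacency_matrix G vs) l)
    \<and> multiplicity_of (distance_matrix G vs) (poly (dist_poly k g) l)
        = (\<Sum>m \<in> {m. eigenvalue (adjacency_matrix G vs) m
                     \<and> poly (dist_poly k g) m = poly (dist_poly k g) l}.
             multiplicity_of (adjacency_matrix G vs) m)"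
proof -
  have kg: "kg_graph k g G" "card (verts G) = moore_bound k g"
    using assms(1) by (auto simp: minimal_cage_def cage_def)
  interpret graph G using kg(1) by (simp add: kg_graph_def)
  interpret moore_graph G k g vs "g div 2"
    by unfold_locales (use kg assms in \<open>auto simp: kg_graph_def\<close>)
  note D = distance_matrix_eq_mat_poly[OF assms(2)]
  have mult: "multiplicity_of (distance_matrix G vs) (poly pf l)
      = (\<Sum>m \<in> {m. eigenvalue A m \<and> poly pf m = poly pf l}. multiplicity_of A m)"
    unfolding D using A_sym by (intro multiplicity_mat_poly[OF A_carrier])
  moreover have "{m. eigenvalue A m \<and> poly pf m = poly pf l} = {l}" if "3 \<le> k \<or> g \<le> 6"
    using dist_poly_inj[OF assms(2) that _ assms(5)] assms(5) by auto
  moreover have "eigenvalue (distance_matrix G vs) (poly pf l)"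
  proof -
    obtain v where v: "v \<in> carrier_vec n" "v \<noteq> 0\<^sub>v n" "A *\<^sub>v v = l \<cdot>\<^sub>v v"
      using assms(5) by (auto simp: eigenvalue_def eigenvector_def)
    then show ?thesis
      unfolding D eigenvalue_def eigenvector_def
      using mat_poly_mult_eigenvector[OF A_carrier v(1,3), of pf] v(1,2)
      by (intro exI[of _ v]) (simp add: mat_poly_dim[OF A_carrier])
  qed
  ultimately show ?thesis by simp
qed

end
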